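(* Let $f:\mathbb C\to\mathbb R^3$ be a Delaunay surface that is neither (part of) a round sphere nor a right circular cylinder, and let $(f_\lambda)_{\lambda\in S^1}$ be its associated family. Then there are infinitely many $\lambda\in S^1$ such that the corresponding surfaces $f_\lambda$ are pairwise non-congruent, each $f_\lambda$ has screw-motion symmetry, and each $f_\lambda$ is a cylinder, i.e. there is $\delta\in\mathbb C\setminus\{0\}$ with $f_\lambda(z+\delta)=f_\lambda(z)$ for all $z\in\mathbb C$.
   Context: Write $z=x+iy$. A Delaunay surface is a constant mean curvature surface of revolution: a conformal immersion $f:\mathbb C\to\mathbb R^3$ of constant mean curvature $H\neq0$ such that $f(x+s,y)=R_s f(x,y)$ for all $s,x,y\in\mathbb R$, where $(R_s)_{s\in\mathbb R}$ is a non-trivial one-parameter group of rotations about a fixed axis. For a conformal immersion $f:\mathbb C\to\mathbb R^3$ of constant mean curvature $H\ne0$ with induced metric $v^2\,dz\otimes d\bar z$ and Hopf differential $Q\,dz^2$ ($Q=\langle f_{zz},N\rangle$, with $N$ the unit normal), the associated family $(f_\lambda)_{\lambda\in S^1}$ consists of the conformal immersions $f_\lambda:\mathbb C\to\mathbb R^3$, unique up to rigid motion, with the same metric $v^2\,dz\otimes d\bar z$, the same mean curvature $H$, and Hopf differential $\lambda^{-2}Q\,dz^2$. $f_\lambda$ has screw-motion symmetry if there is a non-trivial one-parameter group $(S_s)_{s\in\mathbb R}$ of screw motions of $\mathbb R^3$ (rotations about a fixed axis combined with translations along this axis) with $f_\lambda(x+s,y)=S_s f_\lambda(x,y)$. Two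 immersions $f_\lambda,f_{\lambda'}$ are congruent if $f_{\lambda'}\circ\phi=R\circ f_\lambda$ for some diffeomorphism $\phi$ of $\mathbb C$ and some isometry $R$ of $\mathbb R^3$. *)

theory Defs
  imports "HOL-Analysis.Analysis"
begin

subsection \<open>Smooth maps on the plane\<close>

text \<open>Maps on the plane are functions on \<^typ>\<open>complex\<close>, with \<open>z = x + \<i> y\<close>.\<close>

definition dx :: "(complex \<Rightarrow> 'a::real_normed_vector) \<Rightarrow> complex \<Rightarrow> 'a" where
  "dx f z = frechet_derivative f (at z) 1"

definition dy :: "(complex \<Rightarrow> 'a::real_normed_vector) \<Rightarrow> complex \<Rightarrow> 'a" where
  "dy f z = frechet_derivative f (at z) \<i>"

primrec C_k :: "nat \<Rightarrow> (complex \<Rightarrow> 'a::real_normed_vector) \<Rightarrow> bool" where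
  "C_k 0 f \<longleftrightarrow> continuous_on UNIV f"
| "C_k (Suc k) f \<longleftrightarrow> f differentiable_on UNIV \<and> C_k k (dx f) \<and> C_k k (dy f)"

definition smooth :: "(complex \<Rightarrow> 'a::real_normed_vector) \<Rightarrow> bool" where
  "smooth f \<longleftrightarrow> (\<forall>k. C_k k f)"

definition plane_diffeomorphism :: "(complex \<Rightarrow> complex) \<Rightarrow> bool" where
  "plane_diffeomorphism \<phi> \<longleftrightarrow> bij \<phi> \<and> smooth \<phi> \<and> smooth (inv \<phi>)"

definition dz :: "(complex \<Rightarrow> complex) \<Rightarrow> complex \<Rightarrow> complex" where
  "dz h z = (dx h z - \<i> * dy h z) / 2"


subsection \<open>Conformal immersions into three-space\<close>

text \<open>The induced metric \<open>v\<^sup>2 dz \<otimes> d(cnj z)\<close>, as a real quadratic form, is \<open>v\<^sup>2 (dx\<^sup>2 + dy\<^sup>2)\<close>.\<close>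

definition has_conformal_metric :: "(complex \<Rightarrow> real^3) \<Rightarrow> (complex \<Rightarrow> real) \<Rightarrow> bool" where
  "has_conformal_metric f v \<longleftrightarrow>
     (\<forall>z. v z > 0 \<and> dx f z \<bullet> dx f z = (v z)\<^sup>2 \<and> dy f z \<bullet> dy f z = (v z)\<^sup>2 \<and> dx f z \<bullet> dy f z = 0)"

definition conformal_immersion :: "(complex \<Rightarrow> real^3) \<Rightarrow> bool" where
  "conformal_immersion f \<longleftrightarrow> smooth f \<and> (\<exists>v. has_conformal_metric f v)"

definition unit_normal :: "(complex \<Rightarrow> real^3) \<Rightarrow> complex \<Rightarrow> real^3" where
  "unit_normal f z = sgn (cross3 (dx f z) (dy f z))"

text \<open>Half the trace of the shape operator \<open>I\<^sup>-\<^sup>1 II\<close>, in terms of the coefficients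
  of the first and second fundamental forms.\<close>

definition mean_curvature :: "(complex \<Rightarrow> real^3) \<Rightarrow> complex \<Rightarrow> real" where
  "mean_curvature f z =
     (let E = dx f z \<bullet> dx f z; F = dx f z \<bullet> dy f z; G = dy f z \<bullet> dy f z;
          N = unit_normal f z;
          L = dx (dx f) z \<bullet> N; M = dy (dx f) z \<bullet> N; P = dy (dy f) z \<bullet> N
      in (L * G - 2 * M * F + P * E) / (2 * (E * G - F\<^sup>2)))"

text \<open>The coefficient \<open>Q = \<langle>f\<^sub>z\<^sub>z, N\<rangle>\<close> of the Hopf differential \<open>Q dz\<^sup>2\<close>; the inner product
  is extended complex-bilinearly, since \<open>f\<^sub>z\<^sub>z\<close> has complex components.\<close>

definition hopf :: "(complex \<Rightarrow> real^3) \<Rightarrow> complex \<Rightarrow> complex" where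
  "hopf f z = (\<Sum>i\<in>UNIV. dz (dz (\<lambda>w. complex_of_real (f w $ i))) z
                          * complex_of_real (unit_normal f z $ i))"

definition conformal_cmc :: "(complex \<Rightarrow> real^3) \<Rightarrow> real \<Rightarrow> bool" where
  "conformal_cmc f H \<longleftrightarrow> conformal_immersion f \<and> (\<forall>z. mean_curvature f z = H)"


subsection \<open>Screw motions\<close>

text \<open>The axis is the line through \<open>p\<close> in the direction of the unit vector \<open>u\<close>.
  Rotation by the angle \<open>t\<close> is given by Rodrigues' formula.\<close>

definition rotation_about :: "real^3 \<Rightarrow> real^3 \<Rightarrow> real \<Rightarrow> real^3 \<Rightarrow> real^3" where
  "rotation_about p u t x =
     p + cos t *\<^sub>R (x - p) + sin t *\<^sub>R cross3 u (x - p) + ((1 - cos t) * (u \<bullet> (x - p))) *\<^sub>R u"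

definition screw_motion_about :: "real^3 \<Rightarrow> real^3 \<Rightarrow> real \<Rightarrow> real \<Rightarrow> real^3 \<Rightarrow> real^3" where
  "screw_motion_about p u t h x = rotation_about p u t x + h *\<^sub>R u"

definition one_parameter_group :: "(real \<Rightarrow> real^3 \<Rightarrow> real^3) \<Rightarrow> bool" where
  "one_parameter_group S \<longleftrightarrow>
     S 0 = id \<and> (\<forall>s t. S (s + t) = S s \<circ> S t) \<and> (\<forall>x. continuous_on UNIV (\<lambda>s. S s x))"

definition nontrivial_rotation_group :: "(real \<Rightarrow> real^3 \<Rightarrow> real^3) \<Rightarrow> bool" where
  "nontrivial_rotation_group R \<longleftrightarrow> one_parameter_group R \<and> (\<exists>s. R s \<noteq> id) \<and>
     (\<exists>p u. norm u = 1 \<and> (\<forall>s. \<exists>t. R s = rotation_about p u t))"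

definition nontrivial_screw_group :: "(real \<Rightarrow> real^3 \<Rightarrow> real^3) \<Rightarrow> bool" where
  "nontrivial_screw_group S \<longleftrightarrow> one_parameter_group S \<and> (\<exists>s. S s \<noteq> id) \<and>
     (\<exists>p u. norm u = 1 \<and> (\<forall>s. \<exists>t h. S s = screw_motion_about p u t h))"

definition screw_motion_symmetric :: "(complex \<Rightarrow> real^3) \<Rightarrow> bool" where
  "screw_motion_symmetric f \<longleftrightarrow>
     (\<exists>S. nontrivial_screw_group S \<and> (\<forall>s z. f (z + of_real s) = S s (f z)))"


subsection \<open>Delaunay surfaces and the associated family\<close>

definition delaunay_surface :: "(complex \<Rightarrow> real^3) \<Rightarrow> bool" where
  "delaunay_surface f \<longleftrightarrow> (\<exists>H. H \<noteq> 0 \<and> conformal_cmc f H) \<and>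
     (\<exists>R. nontrivial_rotation_group R \<and> (\<forall>s z. f (z + of_real s) = R s (f z)))"

definition part_of_round_sphere :: "(complex \<Rightarrow> real^3) \<Rightarrow> bool" where
  "part_of_round_sphere f \<longleftrightarrow> (\<exists>c r. r > 0 \<and> range f \<subseteq> sphere c r)"

definition circular_cylinder :: "real^3 \<Rightarrow> real^3 \<Rightarrow> real \<Rightarrow> (real^3) set" where
  "circular_cylinder p u r = {x. infdist x (range (\<lambda>t. p + t *\<^sub>R u)) = r}"

definition part_of_circular_cylinder :: "(complex \<Rightarrow> real^3) \<Rightarrow> bool" where
  "part_of_circular_cylinder f \<longleftrightarrow>
     (\<exists>p u r. norm u = 1 \<and> r > 0 \<and> range f \<subseteq> circular_cylinder p u r)"

text \<open>The immersion \<open>F \<mu>\<close> is only determined up to a rigid motion, for each \<open>\<mu>\<close>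
  separately, so being an associated family is a predicate on \<open>F\<close>. Values of \<open>F\<close> off the
  unit circle are irrelevant.\<close>

definition associated_family ::
    "(complex \<Rightarrow> real^3) \<Rightarrow> (complex \<Rightarrow> complex \<Rightarrow> real^3) \<Rightarrow> bool" where
  "associated_family f F \<longleftrightarrow>
     (\<exists>v H. H \<noteq> 0 \<and> conformal_cmc f H \<and> has_conformal_metric f v \<and>
        (\<forall>\<mu>. norm \<mu> = 1 \<longrightarrow>
           conformal_cmc (F \<mu>) H \<and> has_conformal_metric (F \<mu>) v \<and>
           (\<forall>z. hopf (F \<mu>) z = inverse (\<mu>\<^sup>2) * hopf f z)))"

definition congruent_immersions :: "(complex \<Rightarrow> real^3) \<Rightarrow> (complex \<Rightarrow> real^3) \<Rightarrow> bool" where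
  "congruent_immersions f g \<longleftrightarrow>
     (\<exists>\<phi> R. plane_diffeomorphism \<phi> \<and> (\<forall>x y. dist (R x) (R y) = dist x y) \<and> g \<circ> \<phi> = R \<circ> f)"

definition is_cylinder :: "(complex \<Rightarrow> real^3) \<Rightarrow> bool" where
  "is_cylinder f \<longleftrightarrow> (\<exists>\<delta>. \<delta> \<noteq> 0 \<and> (\<forall>z. f (z + \<delta>) = f z))"

end

theory Submission
  imports Defs "HOL-Complex_Analysis.Cauchy_Integral_Formula"
begin

text \<open>The metric of a Delaunay surface and hence, by the Codazzi equations, its Hopf differential
  \<open>Q dz\<^sup>2\<close> are invariant under translations in \<open>x\<close>, so \<open>Q\<close> is constant. With \<open>W = V' / V\<close>
  for the conformal factor \<open>V\<close> and \<open>L\<close>, \<open>M\<close>, \<open>P\<close> for the second fundamental form, the Gauss and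
  Codazzi equations say that the vector \<open>\<omega> = (M f\<^sub>x - L f\<^sub>y) / V\<^sup>2 - W N\<close> is constant, and then
  \<open>f\<^sub>x = \<omega> \<times> f + \<tau>\<close> with constant \<open>\<tau>\<close>: translations in \<open>x\<close> act by screw motions of angular
  velocity \<open>a = |\<omega>|\<close> and translation speed \<open>h = M / a\<close>. In cylindrical coordinates about the screw axis the
  height has differential \<open>h dx - (L / a) dy\<close> and the angle \<open>a dx + h L / (V\<^sup>2 - h\<^sup>2) dy\<close>.

  The Gauss equation is the sinh-Gordon equation for \<open>ln V\<close>, and reflection in two critical points
  shows that \<open>V\<close> has a period \<open>T\<close>. The surface has the period \<open>s + \<i> T\<close> as soon as the height
  closes, which determines \<open>s\<close>, and the total angle \<open>\<Theta>\<close> is a multiple of \<open>2 \<pi>\<close>. Along the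
  associated family, rotate \<open>Q\<close> to \<open>sgn H |Q| exp (- \<i> \<theta>)\<close>: then \<open>\<Theta>\<close> depends continuously on
  \<open>\<theta>\<close> and tends to infinity as \<open>\<theta>\<close> decreases to \<open>0\<close>, so all large multiples of \<open>2 \<pi>\<close> are
  attained.

  A congruence between two members preserves the metric, hence is a conformal map of the plane with
  bounded stretching factor, affine by Liouville's theorem; as \<open>V\<close> is not constant, it
  preserves the coordinate axes, and therefore the real part of \<open>Q\<close>.\<close>

subsection \<open>Partial derivatives on the plane\<close>

text \<open>Bundles total differentiability with the values of both partial derivatives: the
  calculus rules then yield \<open>dx\<close> and \<open>dy\<close> of compound expressions, and
  uniqueness of the pair turns one identity between maps into two between their derivatives.\<close>

definition has_partials ::
    "(complex \<Rightarrow> 'a::real_normed_vector) \<Rightarrow> 'a \<Rightarrow> 'a \<Rightarrow> complex \<Rightarrow> bool" where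
  "has_partials h a b z \<longleftrightarrow> (h has_derivative (\<lambda>t. Re t *\<^sub>R a + Im t *\<^sub>R b)) (at z)"

lemma has_partials_dx: "has_partials h a b z \<Longrightarrow> dx h z = a"
  and has_partials_dy: "has_partials h a b z \<Longrightarrow> dy h z = b"
  unfolding has_partials_def dx_def dy_def by (simp_all add: frechet_derivative_at [symmetric])

lemma has_partials_unique:
  assumes "has_partials h a b z" "has_partials h c d z"
  shows "a = c" "b = d"
  using assms by (metis has_partials_dx, metis has_partials_dy)

lemma has_partials_differentiable:
  assumes "h differentiable (at z)"
  shows "has_partials h (dx h z) (dy h z) z"
proof -
  have D: "(h has_derivative frechet_derivative h (at z)) (at z)"
    using assms frechet_derivative_works by blast
  then interpret bounded_linear "frechet_derivative h (at z)"
    by (rule has_derivative_bounded_linear)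
  have "frechet_derivative h (at z) t = Re t *\<^sub>R dx h z + Im t *\<^sub>R dy h z" for t
  proof -
    have "t = Re t *\<^sub>R 1 + Im t *\<^sub>R \<i>"
      by (simp add: complex_eq_iff)
    then show ?thesis
      unfolding dx_def dy_def by (metis add scaleR)
  qed
  then have "frechet_derivative h (at z) = (\<lambda>t. Re t *\<^sub>R dx h z + Im t *\<^sub>R dy h z)"
    by blast
  then show ?thesis
    using D by (simp add: has_partials_def)
qed

lemma has_partials_cong:
  "\<lbrakk>has_partials h a b z; a = a'; b = b'\<rbrakk> \<Longrightarrow> has_partials h a' b' z"
  by simp

lemma has_partials_isCont: "has_partials h a b z \<Longrightarrow> isCont h z"
  unfolding has_partials_def using has_derivative_continuous by blast

lemma has_partials_const: "has_partials (\<lambda>z. c) 0 0 z"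
  unfolding has_partials_def by simp

lemma has_partials_add:
  assumes "has_partials h a b z" "has_partials k c d z"
  shows "has_partials (\<lambda>z. h z + k z) (a + c) (b + d) z"
  unfolding has_partials_def
  by (rule has_derivative_eq_rhs [OF has_derivative_add [OF assms [unfolded has_partials_def]]])
     (simp add: fun_eq_iff algebra_simps)

lemma has_partials_diff:
  assumes "has_partials h a b z" "has_partials k c d z"
  shows "has_partials (\<lambda>z. h z - k z) (a - c) (b - d) z"
  unfolding has_partials_def
  by (rule has_derivative_eq_rhs [OF has_derivative_diff [OF assms [unfolded has_partials_def]]])
     (simp add: fun_eq_iff algebra_simps)

lemma has_partials_linear:
  assumes "bounded_linear A" "has_partials h a b z"
  shows "has_partials (\<lambda>z. A (h z)) (A a) (A b) z"
  using bounded_linear.has_derivative [OF assms(1) assms(2) [unfolded has_partials_def]] assms(1)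
  unfolding has_partials_def by (simp add: bounded_linear.linear linear_add linear_scale)

lemma has_partials_bilinear:
  assumes "bounded_bilinear B" "has_partials h a b z" "has_partials k c d z"
  shows "has_partials (\<lambda>z. B (h z) (k z)) (B a (k z) + B (h z) c) (B b (k z) + B (h z) d) z"
proof -
  interpret bounded_bilinear B by fact
  show ?thesis
    unfolding has_partials_def
    by (rule has_derivative_eq_rhs [OF FDERIV [OF assms(2,3) [unfolded has_partials_def]]])
       (simp add: fun_eq_iff add_left add_right scaleR_left scaleR_right algebra_simps)
qed

lemma bounded_bilinear_cross3: "bounded_bilinear cross3"
  using bilinear_cross by (simp add: bilinear_conv_bounded_bilinear)

lemmas has_partials_scaleR = has_partials_bilinear [OF bounded_bilinear_scaleR]
lemmas has_partials_inner = has_partials_bilinear [OF bounded_bilinear_inner]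
lemmas has_partials_cross3 = has_partials_bilinear [OF bounded_bilinear_cross3]

lemma has_partials_chain:
  assumes "has_partials h a b z" "(g has_real_derivative g') (at (h z))"
  shows "has_partials (\<lambda>z. g (h z)) (g' * a) (g' * b) z"
  unfolding has_partials_def
  by (rule has_derivative_eq_rhs
        [OF has_derivative_compose [OF assms(1) [unfolded has_partials_def]
              assms(2) [unfolded has_field_derivative_def]]])
     (simp add: fun_eq_iff algebra_simps)

lemma has_partials_Re: "has_partials Re 1 0 z"
  and has_partials_Im: "has_partials Im 0 1 z"
  unfolding has_partials_def
  by (auto intro!: derivative_eq_intros)

lemma has_partials_of_Im:
  assumes "(g has_real_derivative g') (at (Im z))"
  shows "has_partials (\<lambda>z. g (Im z)) 0 g' z"
  using has_partials_chain [OF has_partials_Im assms] by simp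

lemma has_partials_zero_const:
  fixes h :: "complex \<Rightarrow> 'a::real_normed_vector"
  assumes "\<And>z. has_partials h 0 0 z"
  shows "h z = h w"
proof -
  have "\<exists>c. \<forall>x\<in>UNIV. h x = c"
    using assms unfolding has_partials_def
    by (intro has_derivative_zero_constant) (simp_all add: has_derivative_at_withinI)
  then show ?thesis by auto
qed

lemma has_partials_horizontal:
  assumes "has_partials h a b (z + of_real s)"
  shows "((\<lambda>s. h (z + of_real s)) has_vector_derivative a) (at s)"
proof -
  have "((\<lambda>s. z + of_real s) has_derivative of_real) (at s)"
    by (auto intro!: derivative_eq_intros)
  from has_derivative_compose [OF this assms [unfolded has_partials_def]]
  show ?thesis
    unfolding has_vector_derivative_def by simp
qed

lemma has_partials_vertical:
  assumes "has_partials h a b (Complex x y)"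
  shows "((\<lambda>y. h (Complex x y)) has_vector_derivative b) (at y)"
proof -
  have "((\<lambda>y. Complex x y) has_derivative (\<lambda>t. of_real t * \<i>)) (at y)"
    unfolding Complex_eq by (auto intro!: derivative_eq_intros simp: mult.commute)
  from has_derivative_compose [OF this assms [unfolded has_partials_def]]
  show ?thesis
    unfolding has_vector_derivative_def by simp
qed

text \<open>Schwarz's theorem by differentiation under the integral sign: a horizontal integral of
  \<open>p\<close> is an increment of \<open>h\<close>, so that of \<open>b\<close> is an increment
  of \<open>q\<close>, which is also the integral of \<open>c\<close>.\<close>

lemma mixed_partials_eq:
  fixes h :: "complex \<Rightarrow> 'a::banach"
  assumes h: "\<And>z. has_partials h (p z) (q z) z"
    and p: "\<And>z. has_partials p (a z) (b z) z"
    and q: "\<And>z. has_partials q (c z) (d z) z"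
    and "continuous_on UNIV b" "continuous_on UNIV c"
  shows "b z = c z"
proof -
  define x0 where "x0 = Re z"
  define y0 where "y0 = Im z"
  have line: "continuous_on S (\<lambda>t. Complex t y0)" for S
    by (auto simp: Complex_eq intro!: continuous_intros)
  have cont: "continuous_on S (\<lambda>t. b (Complex t y0))" "continuous_on S (\<lambda>t. c (Complex t y0))" for S
    by (rule continuous_on_compose2 [OF assms(4) line] continuous_on_compose2 [OF assms(5) line], simp)+
  have "isCont p z" for z
    using p has_partials_isCont by blast
  then have contp: "continuous_on UNIV p"
    by (simp add: continuous_at_imp_continuous_on)
  have horiz: "((\<lambda>t. k (Complex t y)) has_vector_derivative k' (Complex t y)) (at t)"
    if "\<And>z. has_partials k (k' z) (k'' z) z" for k k' k'' :: "complex \<Rightarrow> 'a" and t y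
  proof -
    have "Complex 0 y + of_real t = Complex t y" for t by (simp add: complex_eq_iff)
    then show ?thesis
      using has_partials_horizontal [of k "k' (Complex t y)" "k'' (Complex t y)" "Complex 0 y" t]
        that by simp
  qed
  have FTC: "((\<lambda>t. k' (Complex t y)) has_integral k (Complex x y) - k (Complex x0 y)) {x0..x}"
    if "\<And>z. has_partials k (k' z) (k'' z) z" "x0 \<le> x" for k k' k'' :: "complex \<Rightarrow> 'a" and x y
    using that horiz [of k k' k'']
    by (intro fundamental_theorem_of_calculus) (auto intro: has_vector_derivative_at_within)
  have eq: "integral {x0..x} (\<lambda>t. b (Complex t y0)) = integral {x0..x} (\<lambda>t. c (Complex t y0))"
    if x: "x0 \<le> x" for x
  proof -
    have 1: "((\<lambda>y. integral (cbox x0 x) (\<lambda>t. p (Complex t y))) has_vector_derivative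
          integral (cbox x0 x) (\<lambda>t. b (Complex t y0))) (at y0 within UNIV)"
    proof (rule leibniz_rule_vector_derivative)
      fix y t :: real
      show "((\<lambda>y. p (Complex t y)) has_vector_derivative b (Complex t y)) (at y within UNIV)"
        using has_partials_vertical [OF p] by simp
      show "(\<lambda>t. p (Complex t y)) integrable_on cbox x0 x"
        using FTC [of h p q, OF h x] by auto
      have "continuous_on (UNIV \<times> cbox x0 x) (\<lambda>yt. b (Complex (snd yt) (fst yt)))"
        by (rule continuous_on_compose2 [OF assms(4)])
           (auto simp: Complex_eq intro!: continuous_intros)
      then show "continuous_on (UNIV \<times> cbox x0 x) (\<lambda>(y, t). b (Complex t y))"
        by (simp add: case_prod_unfold)
    qed auto
    have "integral (cbox x0 x) (\<lambda>t. p (Complex t y)) = h (Complex x y) - h (Complex x0 y)" for y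
      using FTC [of h p q, OF h x] by (simp add: integral_unique)
    then have "((\<lambda>y. h (Complex x y) - h (Complex x0 y)) has_vector_derivative
          integral (cbox x0 x) (\<lambda>t. b (Complex t y0))) (at y0)"
      using 1 by simp
    moreover have "((\<lambda>y. h (Complex x y) - h (Complex x0 y)) has_vector_derivative
          q (Complex x y0) - q (Complex x0 y0)) (at y0)"
      by (intro has_vector_derivative_diff has_partials_vertical [OF h])
    ultimately have "integral (cbox x0 x) (\<lambda>t. b (Complex t y0)) = q (Complex x y0) - q (Complex x0 y0)"
      using vector_derivative_unique_at by blast
    also have "\<dots> = integral (cbox x0 x) (\<lambda>t. c (Complex t y0))"
      using FTC [of q c d x y0, OF q x] by (metis integral_unique box_real(2))
    finally show ?thesis by simp
  qed
  \<comment> \<open>The integrals agree only for \<open>x0 \<le> x\<close>, so the integrands are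
    recovered as one-sided derivatives at \<open>x0\<close>.\<close>
  have "((\<lambda>x. integral {x0..x} (\<lambda>t. b (Complex t y0))) has_vector_derivative b (Complex x0 y0))
      (at x0 within {x0..x0 + 1})"
    by (rule integral_has_vector_derivative) (use cont in auto)
  then have "((\<lambda>x. integral {x0..x} (\<lambda>t. c (Complex t y0))) has_vector_derivative b (Complex x0 y0))
      (at x0 within {x0..x0 + 1})"
    by (rule has_vector_derivative_transform [rotated 2]) (auto simp: eq)
  moreover have "((\<lambda>x. integral {x0..x} (\<lambda>t. c (Complex t y0))) has_vector_derivative c (Complex x0 y0))
      (at x0 within {x0..x0 + 1})"
    by (rule integral_has_vector_derivative) (use cont in auto)
  ultimately have "b (Complex x0 y0) = c (Complex x0 y0)"
    by (intro vector_derivative_unique_within_closed_interval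
          [of x0 "x0 + 1" x0 "\<lambda>x. integral {x0..x} (\<lambda>t. c (Complex t y0))"]) auto
  then show ?thesis by (simp add: x0_def y0_def)
qed

lemma smooth_dx: "smooth f \<Longrightarrow> smooth (dx f)"
  and smooth_dy: "smooth f \<Longrightarrow> smooth (dy f)"
  unfolding smooth_def by (metis C_k.simps(2))+

lemma smooth_has_partials:
  assumes "smooth f" shows "has_partials f (dx f z) (dy f z) z"
proof -
  have "C_k (Suc 0) f" using assms by (simp only: smooth_def)
  then have "f differentiable (at z)" by (simp add: differentiable_on_def)
  then show ?thesis by (rule has_partials_differentiable)
qed

lemma smooth_continuous: "smooth f \<Longrightarrow> continuous_on UNIV f"
  unfolding smooth_def by (metis C_k.simps(1))

lemma smooth_dx_dy:
  fixes f :: "complex \<Rightarrow> 'a::banach"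
  assumes "smooth f" shows "dx (dy f) z = dy (dx f) z"
  by (rule mixed_partials_eq [symmetric, of f "dx f" "dy f" "dx (dx f)" _ _ "dy (dy f)"])
     (use assms in \<open>auto intro: smooth_has_partials smooth_continuous smooth_dx smooth_dy\<close>)

subsection \<open>Orthogonal frames\<close>

text \<open>Meant for the coordinate tangents \<open>a\<close>, \<open>b\<close> of a conformal
  immersion, with \<open>c\<close> the squared conformal factor. The expansion of \<open>w\<close>
  comes from evaluating the double cross product of \<open>n\<close>, \<open>n\<close>,
  \<open>w\<close> in two ways: directly by Lagrange's identity, and after replacing
  \<open>c n\<close> by \<open>cross3 a b\<close>.\<close>

lemma orthogonal_frame:
  fixes a b n :: "real^3"
  assumes "c > 0" "a \<bullet> a = c" "b \<bullet> b = c" "a \<bullet> b = 0" and n: "n = (1 / c) *\<^sub>R cross3 a b"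
  shows "n \<bullet> n = 1" "n \<bullet> a = 0" "n \<bullet> b = 0"
    and "cross3 a b = c *\<^sub>R n" "cross3 b n = a" "cross3 n a = b"
    and "w = ((w \<bullet> a) / c) *\<^sub>R a + ((w \<bullet> b) / c) *\<^sub>R b + (w \<bullet> n) *\<^sub>R n"
proof -
  have ba: "b \<bullet> a = 0" using assms by (simp add: inner_commute)
  show na: "n \<bullet> a = 0" "n \<bullet> b = 0"
    by (simp_all add: n dot_cross_self)
  have "cross3 a b \<bullet> cross3 a b = c * c"
    using norm_cross_dot [of a b] assms(2-4)
    by (metis add.right_neutral power2_eq_square power2_norm_eq_inner power_mult_distrib zero_power2)
  then show nn: "n \<bullet> n = 1"
    using assms(1) by (simp add: n)
  show ab: "cross3 a b = c *\<^sub>R n"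
    using assms(1) by (simp add: n)
  show bn: "cross3 b n = a"
    using assms(1-4) ba by (simp add: n cross_mult_right Lagrange)
  have "cross3 n a = - cross3 a n" by (rule cross_skew)
  also have "\<dots> = b"
    using assms(1-4) by (simp add: n cross_mult_right Lagrange)
  finally show na': "cross3 n a = b" .
  have an: "cross3 a n = - b" using na' cross_skew by metis
  have w: "cross3 (cross3 a b) w = (a \<bullet> w) *\<^sub>R b - (b \<bullet> w) *\<^sub>R a"
    using Lagrange [of w a b] cross_skew [of "cross3 a b" w] by (simp add: inner_commute)
  have "cross3 (c *\<^sub>R n) (cross3 (c *\<^sub>R n) w) = (c * c) *\<^sub>R ((n \<bullet> w) *\<^sub>R n - w)"
    by (simp add: Lagrange nn cross_mult_left cross_mult_right algebra_simps)
  also have "cross3 (c *\<^sub>R n) (cross3 (c *\<^sub>R n) w) = cross3 (c *\<^sub>R n) ((a \<bullet> w) *\<^sub>R b - (b \<bullet> w) *\<^sub>R a)"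
    using w by (simp only: ab)
  also have "\<dots> = c *\<^sub>R ((a \<bullet> w) *\<^sub>R cross3 n b - (b \<bullet> w) *\<^sub>R cross3 n a)"
    by (simp add: scaleR_diff_right mult.commute Cross3.right_diff_distrib cross_mult_left cross_mult_right)
  also have "cross3 n b = - a" using bn cross_skew by metis
  finally have "c *\<^sub>R (c *\<^sub>R w) = c *\<^sub>R ((a \<bullet> w) *\<^sub>R a + (b \<bullet> w) *\<^sub>R b + c *\<^sub>R ((n \<bullet> w) *\<^sub>R n))"
    by (simp add: na' algebra_simps)
  then have "c *\<^sub>R w = (a \<bullet> w) *\<^sub>R a + (b \<bullet> w) *\<^sub>R b + c *\<^sub>R ((n \<bullet> w) *\<^sub>R n)"
    unfolding scaleR_cancel_left using assms(1) by simp
  then have "(1 / c) *\<^sub>R (c *\<^sub>R w) = (1 / c) *\<^sub>R ((a \<bullet> w) *\<^sub>R a + (b \<bullet> w) *\<^sub>R b + c *\<^sub>R ((n \<bullet> w) *\<^sub>R n))"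
    by simp
  then show "w = ((w \<bullet> a) / c) *\<^sub>R a + ((w \<bullet> b) / c) *\<^sub>R b + (w \<bullet> n) *\<^sub>R n"
    using assms(1) by (simp add: scaleR_add_right inner_commute)
qed

subsection \<open>Surfaces whose metric depends only on \<open>y\<close>\<close>

text \<open>With \<open>V\<close> as a parameter, all members of an associated family are instances
  with the same \<open>V\<close> and \<open>H\<close>. The regularity of \<open>V\<close> is
  inherited from that of \<open>f\<close>.\<close>

locale band_cmc =
  fixes f :: "complex \<Rightarrow> real^3" and V :: "real \<Rightarrow> real" and H :: real
  assumes smooth_f: "smooth f"
    and metric: "has_conformal_metric f (\<lambda>z. V (Im z))"
    and mean: "mean_curvature f z = H"
    and H_nonzero: "H \<noteq> 0"
begin

section \<open>The moving frame: structure and Weingarten equations\<close>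

abbreviation "fx \<equiv> dx f"
abbreviation "fy \<equiv> dy f"
abbreviation "N \<equiv> unit_normal f"

definition "L z = dx fx z \<bullet> N z"
definition "M z = dy fx z \<bullet> N z"
definition "P z = dy fy z \<bullet> N z"
definition "W y = deriv V y / V y"

lemma V_pos: "V y > 0"
  using metric [unfolded has_conformal_metric_def, rule_format, of "Complex 0 y"] by simp

lemma V_nz [simp]: "V y \<noteq> 0"
  using V_pos [of y] by simp

lemma fx_fx: "fx z \<bullet> fx z = (V (Im z))\<^sup>2"
  and fy_fy: "fy z \<bullet> fy z = (V (Im z))\<^sup>2"
  and fx_fy: "fx z \<bullet> fy z = 0"
  and fy_fx: "fy z \<bullet> fx z = 0"
  using metric by (simp_all add: has_conformal_metric_def inner_commute)

lemma N_eq: "N z = (1 / (V (Im z))\<^sup>2) *\<^sub>R cross3 (fx z) (fy z)"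
proof -
  have "(norm (cross3 (fx z) (fy z)))\<^sup>2 = ((V (Im z))\<^sup>2)\<^sup>2"
    using norm_cross_dot [of "fx z" "fy z"] fx_fx [of z] fy_fy [of z] fx_fy [of z]
    by (simp add: power_mult_distrib power2_norm_eq_inner)
  then have "norm (cross3 (fx z) (fy z)) = (V (Im z))\<^sup>2"
    by (metis norm_ge_zero power2_eq_imp_eq zero_le_power2)
  then show ?thesis
    by (simp add: unit_normal_def sgn_div_norm divide_inverse)
qed

lemmas frame = orthogonal_frame
  [OF zero_less_power [OF V_pos] fx_fx fy_fy fx_fy N_eq]

lemma N_simps: "N z \<bullet> N z = 1" "N z \<bullet> fx z = 0" "N z \<bullet> fy z = 0" "fx z \<bullet> N z = 0" "fy z \<bullet> N z = 0"
  using frame(1-3) [of z] by (simp_all add: inner_commute)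

lemmas inner_frame = fx_fx fy_fy fx_fy fy_fx N_simps

lemma partials:
  "has_partials f (fx z) (fy z) z"
  "has_partials fx (dx fx z) (dy fx z) z"
  "has_partials fy (dy fx z) (dy fy z) z"
  "has_partials (dx fx) (dx (dx fx) z) (dy (dx fx) z) z"
  "has_partials (dy fx) (dy (dx fx) z) (dy (dy fx) z) z"
  "has_partials (dy fy) (dy (dy fx) z) (dy (dy fy) z) z"
proof -
  note [intro] = smooth_f smooth_dx smooth_dy smooth_has_partials
  have eq: "dx fy = dy fx"
    using smooth_dx_dy [OF smooth_f] by blast
  show "has_partials f (fx z) (fy z) z"
    "has_partials fx (dx fx z) (dy fx z) z"
    "has_partials (dx fx) (dx (dx fx) z) (dy (dx fx) z) z" by blast+
  show "has_partials fy (dy fx z) (dy fy z) z"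
    unfolding eq [symmetric] by blast
  show "has_partials (dy fx) (dy (dx fx) z) (dy (dy fx) z) z"
    unfolding smooth_dx_dy [OF smooth_dx [OF smooth_f], symmetric] by blast
  show "has_partials (dy fy) (dy (dy fx) z) (dy (dy fy) z) z"
    unfolding eq [symmetric]
    unfolding smooth_dx_dy [OF smooth_dy [OF smooth_f], symmetric] by blast
qed

text \<open>On the imaginary axis \<open>V\<close> is the square root of the positive differentiable
  function \<open>fx \<bullet> fx\<close>. This makes \<open>W\<close>, defined through
  \<open>deriv\<close>, the genuine logarithmic derivative of \<open>V\<close>.\<close>

lemma deriv_V: "(V has_real_derivative V y * W y) (at y)"
proof -
  have eq: "V y = sqrt (fx (Complex 0 y) \<bullet> fx (Complex 0 y))" for y
    using V_pos [of y] by (simp add: fx_fx real_sqrt_abs)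
  have "((\<lambda>y. fx (Complex 0 y) \<bullet> fx (Complex 0 y)) has_real_derivative
      dy fx (Complex 0 y) \<bullet> fx (Complex 0 y) + fx (Complex 0 y) \<bullet> dy fx (Complex 0 y)) (at y)"
    using has_partials_vertical [OF has_partials_inner [OF partials(2) partials(2)]]
    by (simp add: has_real_derivative_iff_has_vector_derivative)
  from DERIV_chain2 [OF DERIV_real_sqrt this] have "\<exists>D. (V has_real_derivative D) (at y)"
    using V_pos [of y] unfolding eq [abs_def] by (auto simp: fx_fx)
  then show ?thesis
    by (auto simp: W_def dest: DERIV_imp_deriv)
qed

lemma deriv_V2: "((\<lambda>y. (V y)\<^sup>2) has_real_derivative 2 * (V y)\<^sup>2 * W y) (at y)"
  by (auto intro!: derivative_eq_intros deriv_V simp: power2_eq_square)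

text \<open>The Christoffel symbols: differentiating the three relations between \<open>fx\<close>
  and \<open>fy\<close> in both directions gives six linear equations for these six
  products.\<close>

lemma second_derivative_inner:
  "dx fx z \<bullet> fx z = 0" "dy fx z \<bullet> fx z = (V (Im z))\<^sup>2 * W (Im z)"
  "dy fx z \<bullet> fy z = 0" "dy fy z \<bullet> fy z = (V (Im z))\<^sup>2 * W (Im z)"
  "dx fx z \<bullet> fy z = - (V (Im z))\<^sup>2 * W (Im z)" "dy fy z \<bullet> fx z = 0"
proof -
  have E: "has_partials (\<lambda>z. (V (Im z))\<^sup>2) 0 (2 * (V (Im z))\<^sup>2 * W (Im z)) z"
    by (rule has_partials_of_Im [OF deriv_V2])
  note 1 = has_partials_unique [OF has_partials_inner [OF partials(2) partials(2)] E [folded fx_fx]]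
  note 2 = has_partials_unique [OF has_partials_inner [OF partials(3) partials(3)] E [folded fy_fy]]
  have "has_partials (\<lambda>z. fx z \<bullet> fy z) 0 0 z"
    by (simp add: fx_fy has_partials_const)
  note 3 = has_partials_unique [OF has_partials_inner [OF partials(2) partials(3)] this]
  show eqs: "dx fx z \<bullet> fx z = 0" "dy fx z \<bullet> fx z = (V (Im z))\<^sup>2 * W (Im z)"
     "dy fx z \<bullet> fy z = 0" "dy fy z \<bullet> fy z = (V (Im z))\<^sup>2 * W (Im z)"
    using 1 2 inner_commute [of "fx z"] inner_commute [of "fy z"]
    by (simp_all add: fx_fx fy_fy)
  show "dx fx z \<bullet> fy z = - (V (Im z))\<^sup>2 * W (Im z)" "dy fy z \<bullet> fx z = 0"
    using 3 eqs inner_commute [of "fx z" "dy fx z"] inner_commute [of "fx z" "dy fy z"] by simp_all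
qed

lemma structure_equations:
  "dx fx z = (- W (Im z)) *\<^sub>R fy z + L z *\<^sub>R N z"
  "dy fx z = W (Im z) *\<^sub>R fx z + M z *\<^sub>R N z"
  "dy fy z = W (Im z) *\<^sub>R fy z + P z *\<^sub>R N z"
  using frame(7) [of "dx fx z" z] frame(7) [of "dy fx z" z] frame(7) [of "dy fy z" z]
  by (simp_all add: second_derivative_inner L_def M_def P_def)

definition "Nx z = (- 1 / (V (Im z))\<^sup>2) *\<^sub>R (L z *\<^sub>R fx z + M z *\<^sub>R fy z)"
definition "Ny z = (- 1 / (V (Im z))\<^sup>2) *\<^sub>R (M z *\<^sub>R fx z + P z *\<^sub>R fy z)"

text \<open>The Weingarten equations. The cross product formula is used only for the existence of
  the partial derivatives; their frame coefficients come from differentiating the constant products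
  of \<open>N\<close> with \<open>N\<close>, \<open>fx\<close> and \<open>fy\<close>.\<close>

lemma partials_N: "has_partials N (Nx z) (Ny z) z"
proof -
  have "has_partials (\<lambda>z. 1 / (V (Im z))\<^sup>2) 0 (- 2 * W (Im z) / (V (Im z))\<^sup>2) z"
    by (rule has_partials_of_Im)
       (auto intro!: derivative_eq_intros deriv_V simp: field_simps power2_eq_square)
  from has_partials_scaleR [OF this has_partials_cross3 [OF partials(2,3)]]
  obtain A B where AB: "has_partials N A B z"
    unfolding N_eq [symmetric] by blast
  have "has_partials (\<lambda>z. N z \<bullet> N z) 0 0 z"
    by (simp add: N_simps has_partials_const)
  note 1 = has_partials_unique [OF has_partials_inner [OF AB AB] this]
  have "has_partials (\<lambda>z. N z \<bullet> fx z) 0 0 z"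
    by (simp add: N_simps has_partials_const)
  note 2 = has_partials_unique [OF has_partials_inner [OF AB partials(2)] this]
  have "has_partials (\<lambda>z. N z \<bullet> fy z) 0 0 z"
    by (simp add: N_simps has_partials_const)
  note 3 = has_partials_unique [OF has_partials_inner [OF AB partials(3)] this]
  have "A = Nx z" "B = Ny z"
    using frame(7) [of A z] frame(7) [of B z] 1 2 3
    by (simp_all add: Nx_def Ny_def L_def M_def P_def inner_commute eq_neg_iff_add_eq_0 [symmetric]
        scaleR_right_distrib add.commute)
  then show ?thesis using AB by simp
qed

lemma N_derivative_inner:
  "Nx z \<bullet> fx z = - L z" "Nx z \<bullet> fy z = - M z" "Nx z \<bullet> N z = 0"
  "Ny z \<bullet> fx z = - M z" "Ny z \<bullet> fy z = - P z" "Ny z \<bullet> N z = 0"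
  by (simp_all add: Nx_def Ny_def inner_add_left inner_frame)

lemma mean_curvature_LP: "L z + P z = 2 * H * (V (Im z))\<^sup>2"
proof -
  have "H = (L z * (V (Im z))\<^sup>2 + P z * (V (Im z))\<^sup>2) / (2 * ((V (Im z))\<^sup>2 * (V (Im z))\<^sup>2))"
    using mean [of z] by (simp add: mean_curvature_def Let_def inner_frame L_def P_def)
  also have "\<dots> = (L z + P z) / (2 * (V (Im z))\<^sup>2)"
    by (simp add: field_simps)
  finally show ?thesis by (simp add: field_simps)
qed

text \<open>In each component, applying \<open>dz\<close> twice gives
  \<open>(f_xx - f_yy - 2 \<i> f_xy) / 4\<close>.\<close>

lemma hopf_eq: "hopf f z = Complex ((L z - P z) / 4) (- M z / 2)"
proof -
  have dz: "dz (\<lambda>w. of_real (f w $ i)) = (\<lambda>z. (of_real (fx z $ i) - \<i> * of_real (fy z $ i)) / 2)" for i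
  proof
    fix z
    have "has_partials (\<lambda>w. complex_of_real (f w $ i)) (of_real (fx z $ i)) (of_real (fy z $ i)) z"
      by (intro has_partials_linear [OF bounded_linear_of_real]
          has_partials_linear [OF bounded_linear_vec_nth] partials)
    then show "dz (\<lambda>w. of_real (f w $ i)) z = (of_real (fx z $ i) - \<i> * of_real (fy z $ i)) / 2"
      unfolding dz_def by (simp add: has_partials_dx has_partials_dy)
  qed
  have dzdz: "dz (dz (\<lambda>w. of_real (f w $ i))) z
      = (of_real (dx fx z $ i - dy fy z $ i) - 2 * \<i> * of_real (dy fx z $ i)) / 4" for i
  proof -
    have *: "has_partials (\<lambda>w. complex_of_real (g w $ i)) (of_real (a $ i)) (of_real (b $ i)) z"
      if "has_partials g a b z" for g and a b :: "real^3"
      by (intro has_partials_linear [OF bounded_linear_of_real]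
          has_partials_linear [OF bounded_linear_vec_nth] that)
    have "bounded_linear (\<lambda>w::complex. w / 2)" "bounded_linear (\<lambda>w. \<i> * w)"
      by (rule bounded_linear_divide, rule bounded_linear_mult_right)
    note ** = has_partials_linear [OF this(1) has_partials_diff [OF * [OF partials(2)]
              has_partials_linear [OF this(2) * [OF partials(3)]]]]
    have "dz (dz (\<lambda>w. of_real (f w $ i))) z
      = ((of_real (dx fx z $ i) - \<i> * of_real (dy fx z $ i)) / 2
         - \<i> * ((of_real (dy fx z $ i) - \<i> * of_real (dy fy z $ i)) / 2)) / 2"
      unfolding dz unfolding dz_def has_partials_dx [OF **] has_partials_dy [OF **] ..
    also have "\<dots> = (of_real (dx fx z $ i - dy fy z $ i) - 2 * \<i> * of_real (dy fx z $ i)) / 4"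
      by (simp add: field_simps)
    finally show ?thesis .
  qed
  show ?thesis
    unfolding hopf_def dzdz L_def P_def M_def
    by (simp add: complex_eq_iff inner_vec_def sum_3 algebra_simps add_divide_distrib diff_divide_distrib)
qed

text \<open>The Gauss equation, since \<open>W\<close> is the derivative of \<open>ln V\<close>. The
  third derivative \<open>f_xxy\<close> enters through the \<open>y\<close>-derivative of
  \<open>fy \<bullet> f_xx\<close> and is eliminated by the \<open>x\<close>-derivative of
  \<open>fy \<bullet> f_xy = 0\<close>.\<close>

lemma gauss: "(W has_real_derivative ((M z)\<^sup>2 - L z * P z) / (V (Im z))\<^sup>2) (at (Im z))"
proof -
  have "has_partials (\<lambda>z. fy z \<bullet> dy fx z) (dy fx z \<bullet> dy fx z + fy z \<bullet> dy (dx fx) z)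
     (dy fy z \<bullet> dy fx z + fy z \<bullet> dy (dy fx) z) z"
    by (intro has_partials_inner partials)
  moreover have "has_partials (\<lambda>z. fy z \<bullet> dy fx z) 0 0 z"
    using second_derivative_inner(3) by (simp add: inner_commute [of "fy _"] has_partials_const)
  ultimately have 1: "fy z \<bullet> dy (dx fx) z = - (dy fx z \<bullet> dy fx z)"
    using has_partials_unique by fastforce
  have q: "has_partials (\<lambda>z. fy z \<bullet> dx fx z) (dy fx z \<bullet> dx fx z + fy z \<bullet> dx (dx fx) z)
     (dy fy z \<bullet> dx fx z + fy z \<bullet> dy (dx fx) z) z"
    by (intro has_partials_inner partials)
  have "dy fy z \<bullet> dx fx z + fy z \<bullet> dy (dx fx) z
      = L z * P z - (M z)\<^sup>2 - 2 * (V (Im z))\<^sup>2 * (W (Im z))\<^sup>2"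
    by (simp add: 1 structure_equations inner_add_left inner_add_right inner_diff_left inner_diff_right
        inner_frame power2_eq_square)
  then have "has_partials (\<lambda>z. fy z \<bullet> dx fx z) (dy fx z \<bullet> dx fx z + fy z \<bullet> dx (dx fx) z)
     (L z * P z - (M z)\<^sup>2 - 2 * (V (Im z))\<^sup>2 * (W (Im z))\<^sup>2) z"
    using q by simp
  then have "has_partials (\<lambda>z. fy z \<bullet> dx fx z) (dy fx z \<bullet> dx fx z + fy z \<bullet> dx (dx fx) z)
     (L z * P z - (M z)\<^sup>2 - 2 * (V (Im z))\<^sup>2 * (W (Im z))\<^sup>2) (Complex (Re z) (Im z))"
    by simp
  from has_partials_vertical [OF this]
  have "((\<lambda>y. fy (Complex (Re z) y) \<bullet> dx fx (Complex (Re z) y)) has_real_derivative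
     (L z * P z - (M z)\<^sup>2 - 2 * (V (Im z))\<^sup>2 * (W (Im z))\<^sup>2)) (at (Im z))"
    by (simp add: has_real_derivative_iff_has_vector_derivative)
  then have "((\<lambda>y. - (V y)\<^sup>2 * W y) has_real_derivative
     (L z * P z - (M z)\<^sup>2 - 2 * (V (Im z))\<^sup>2 * (W (Im z))\<^sup>2)) (at (Im z))"
    by (simp add: second_derivative_inner(5) inner_commute [of "fy _"])
  from DERIV_divide [OF this DERIV_minus [OF deriv_V2]]
  have "((\<lambda>y. - (V y)\<^sup>2 * W y / - (V y)\<^sup>2) has_real_derivative
     ((M z)\<^sup>2 - L z * P z) / (V (Im z))\<^sup>2) (at (Im z))"
    by (rule DERIV_cong) (simp_all add: field_simps power2_eq_square)
  then show ?thesis by simp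
qed

section \<open>The Codazzi equations\<close>

lemma partials_L: "has_partials L (dx (dx fx) z \<bullet> N z + dx fx z \<bullet> Nx z) (dy (dx fx) z \<bullet> N z + dx fx z \<bullet> Ny z) z"
  and partials_M: "has_partials M (dy (dx fx) z \<bullet> N z + dy fx z \<bullet> Nx z) (dy (dy fx) z \<bullet> N z + dy fx z \<bullet> Ny z) z"
  and partials_P: "has_partials P (dy (dy fx) z \<bullet> N z + dy fy z \<bullet> Nx z) (dy (dy fy) z \<bullet> N z + dy fy z \<bullet> Ny z) z"
  unfolding L_def [abs_def] M_def [abs_def] P_def [abs_def]
  by (intro has_partials_inner partials partials_N)+

text \<open>Invariance in \<open>x\<close> removes the \<open>x\<close>-derivatives of
  \<open>L\<close>, \<open>M\<close> and \<open>P\<close>. By the Codazzi equations \<open>M\<close>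
  is then constant and \<open>L\<close> has the same \<open>y\<close>-derivative as
  \<open>H V^2\<close>, so that \<open>L - P = 2 (L - H V^2)\<close> is constant as well.\<close>

lemma codazzi_constant:
  assumes L: "\<And>z s. L (z + of_real s) = L z" and M: "\<And>z s. M (z + of_real s) = M z"
  shows "hopf f z = hopf f w"
proof -
  have horizontal_zero: "a = 0"
    if "has_partials g a b z" "\<And>s. g (z + of_real s) = g z" for g :: "complex \<Rightarrow> real" and a b z
    using has_partials_horizontal [of g a b z 0] that
    by (simp add: vector_derivative_unique_at [OF has_vector_derivative_const])
  have P_eq: "P z = 2 * H * (V (Im z))\<^sup>2 - L z" for z
    using mean_curvature_LP [of z] by simp
  have P: "P (z + of_real s) = P z" for z s
    by (simp add: P_eq L)
  have M_const: "has_partials M 0 0 z" for z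
  proof -
    \<comment> \<open>The Codazzi equation \<open>M_y = P_x\<close>: both sides contain
      \<open>f_xyy \<bullet> N\<close>, and the remaining terms are both
      \<open>- W M\<close>.\<close>
    have "dy (dy fx) z \<bullet> N z + dy fx z \<bullet> Ny z = dy (dy fx) z \<bullet> N z + dy fy z \<bullet> Nx z"
      using N_derivative_inner [of z]
      by (simp add: structure_equations inner_add_left inner_add_right inner_commute)
    then show ?thesis
      using partials_M [of z] horizontal_zero [OF partials_M M] horizontal_zero [OF partials_P P]
      by simp
  qed
  have L_const: "has_partials (\<lambda>z. L z - H * (V (Im z))\<^sup>2) 0 0 z" for z
  proof -
    have "dy (dx fx) z \<bullet> N z = - (dy fx z \<bullet> Nx z)"
      using horizontal_zero [OF partials_M M] by (simp add: eq_neg_iff_add_eq_0)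
    then have "dy (dx fx) z \<bullet> N z + dx fx z \<bullet> Ny z = 2 * H * (V (Im z))\<^sup>2 * W (Im z)"
      using N_derivative_inner [of z] mean_curvature_LP [of z, symmetric]
      by (simp add: structure_equations inner_add_left inner_add_right inner_commute algebra_simps)
    then have "has_partials L 0 (H * (2 * (V (Im z))\<^sup>2 * W (Im z))) z"
      using partials_L [of z] horizontal_zero [OF partials_L L] by (simp add: mult.assoc mult.left_commute)
    from has_partials_diff [OF this has_partials_of_Im [OF DERIV_cmult [OF deriv_V2, of H]]]
    show ?thesis by simp
  qed
  have "M z = M w" "L z - H * (V (Im z))\<^sup>2 = L w - H * (V (Im w))\<^sup>2"
    using has_partials_zero_const [OF M_const] has_partials_zero_const [OF L_const] by blast+
  then show ?thesis
    by (simp add: hopf_eq P_eq)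
qed

end

subsection \<open>The conformal factor\<close>

text \<open>Gronwall in both directions: the factor \<open>exp (- C y)\<close> makes
  \<open>D\<close> nonincreasing to the right of \<open>y0\<close>, and \<open>exp (C y)\<close>
  makes it nondecreasing to the left.\<close>

lemma gronwall_zero:
  fixes D D' :: "real \<Rightarrow> real"
  assumes D: "\<And>y. (D has_real_derivative D' y) (at y)"
    and bound: "\<And>y. \<bar>D' y\<bar> \<le> C * D y"
    and nonneg: "\<And>y. D y \<ge> 0" and zero: "D y0 = 0"
  shows "D y = 0"
proof (cases "y0 \<le> y")
  case True
  have "D y * exp (- C * y) \<le> D y0 * exp (- C * y0)"
  proof (rule DERIV_nonpos_imp_nonincreasing [OF True])
    fix x
    have "((\<lambda>y. D y * exp (- C * y)) has_real_derivative (D' x - C * D x) * exp (- C * x)) (at x)"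
      by (auto intro!: derivative_eq_intros D simp: algebra_simps)
    moreover have "(D' x - C * D x) * exp (- C * x) \<le> 0"
      using bound [of x] by (intro mult_nonpos_nonneg) auto
    ultimately show "\<exists>d. ((\<lambda>y. D y * exp (- C * y)) has_real_derivative d) (at x) \<and> d \<le> 0"
      by blast
  qed
  then show ?thesis
    using nonneg [of y] zero by (simp add: mult_le_0_iff)
next
  case False
  have "D y * exp (C * y) \<le> D y0 * exp (C * y0)"
  proof (rule DERIV_nonneg_imp_nondecreasing [of y y0 "\<lambda>y. D y * exp (C * y)"])
    show "y \<le> y0" using False by simp
    fix x
    have "((\<lambda>y. D y * exp (C * y)) has_real_derivative (D' x + C * D x) * exp (C * x)) (at x)"
      by (auto intro!: derivative_eq_intros D simp: algebra_simps)
    moreover have "(D' x + C * D x) * exp (C * x) \<ge> 0"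
      using bound [of x] by (intro mult_nonneg_nonneg) auto
    ultimately show "\<exists>d. ((\<lambda>y. D y * exp (C * y)) has_real_derivative d) (at x) \<and> d \<ge> 0"
      by blast
  qed
  then show ?thesis
    using nonneg [of y] zero by (simp add: mult_le_0_iff)
qed

text \<open>With \<open>V = c exp \<eta>\<close> for a suitable constant \<open>c\<close>, this is the sinh-Gordon equation
  \<open>\<eta>'' = - 2 sqrt (A B) sinh (2 \<eta>)\<close>.\<close>

locale sinh_gordon =
  fixes V W :: "real \<Rightarrow> real" and A B :: real
  assumes V_pos: "V y > 0" and A_pos: "A > 0" and B_pos: "B > 0"
    and deriv_V: "(V has_real_derivative V y * W y) (at y)"
    and deriv_W: "(W has_real_derivative A / (V y)\<^sup>2 - B * (V y)\<^sup>2) (at y)"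
begin

lemma V_nz [simp]: "V y \<noteq> 0"
  using V_pos [of y] by simp

text \<open>The symmetry of the sinh-Gordon equation under a change of sign of
  \<open>\<eta>\<close>; it transfers statements about growth of \<open>V\<close> to statements
  about decay.\<close>

lemma inverse_solution: "sinh_gordon (\<lambda>y. 1 / V y) (\<lambda>y. - W y) B A"
  by unfold_locales
     (auto intro!: derivative_eq_intros deriv_V deriv_W V_pos A_pos B_pos simp: field_simps power2_eq_square)

text \<open>If \<open>W\<close> stayed positive, \<open>V\<close> would increase. Once
  \<open>W'\<close> is negative it stays below a negative constant and drives \<open>W\<close> to
  zero; if \<open>W'\<close> is never negative, \<open>V\<close> grows at least linearly, which
  eventually makes \<open>W'\<close> negative.\<close>

lemma not_increasing: "\<exists>y\<ge>a. W y \<le> 0"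
proof (rule ccontr)
  assume "\<not> ?thesis"
  then have pos: "W y > 0" if "y \<ge> a" for y
    using that by fastforce
  have V_mono: "V x \<le> V y" if "a \<le> x" "x \<le> y" for x y
    using that deriv_V pos V_pos
    by (intro DERIV_nonneg_imp_nondecreasing [of x y V]) (metis less_imp_le mult_nonneg_nonneg order_trans)+
  show False
  proof (cases "\<exists>b\<ge>a. A / (V b)\<^sup>2 - B * (V b)\<^sup>2 < 0")
    case True
    then obtain b where b: "b \<ge> a" "A / (V b)\<^sup>2 - B * (V b)\<^sup>2 < 0" by blast
    define m where "m = B * (V b)\<^sup>2 - A / (V b)\<^sup>2"
    have m: "m > 0" using b by (simp add: m_def)
    \<comment> \<open>Where the line of slope \<open>- m\<close> through the value
      \<open>W b\<close> at \<open>b\<close> reaches zero.\<close>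
    define c where "c = b + W b / m"
    have "b \<le> c" using pos [of b] b m by (simp add: c_def)
    then have "W c + m * c \<le> W b + m * b"
    proof (rule DERIV_nonpos_imp_nonincreasing)
      fix x assume x: "b \<le> x" "x \<le> c"
      have le: "(V b)\<^sup>2 \<le> (V x)\<^sup>2"
        using V_mono [of b x] b x V_pos [of b] by (intro power_mono) auto
      have "A / (V x)\<^sup>2 \<le> A / (V b)\<^sup>2"
        using le A_pos by (intro divide_left_mono) auto
      moreover have "B * (V b)\<^sup>2 \<le> B * (V x)\<^sup>2"
        using le B_pos by simp
      ultimately have "A / (V x)\<^sup>2 - B * (V x)\<^sup>2 + m \<le> 0"
        by (simp add: m_def)
      moreover have "((\<lambda>y. W y + m * y) has_real_derivative A / (V x)\<^sup>2 - B * (V x)\<^sup>2 + m) (at x)"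
        by (auto intro!: derivative_eq_intros deriv_W)
      ultimately show "\<exists>d. ((\<lambda>y. W y + m * y) has_real_derivative d) (at x) \<and> d \<le> 0" by blast
    qed
    moreover have "m * c = m * b + W b" using m by (simp add: c_def field_simps)
    ultimately have "W c \<le> 0" by linarith
    then show False using pos [of c] b \<open>b \<le> c\<close> by simp
  next
    case False
    have W_mono: "W a \<le> W y" if "a \<le> y" for y
    proof (rule DERIV_nonneg_imp_nondecreasing [OF that])
      fix x assume "a \<le> x"
      then show "\<exists>d. (W has_real_derivative d) (at x) \<and> 0 \<le> d"
        using deriv_W [of x] False by force
    qed
    \<comment> \<open>Growth at rate at least \<open>V a * W a\<close> has by then added
      \<open>1 + A / B\<close> to \<open>V\<close>. The summand \<open>1\<close> makes
      \<open>V c\<close> exceed one, so that its fourth power still exceeds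
      \<open>A / B\<close>.\<close>
    define c where "c = a + (1 + A / B) / (V a * W a)"
    have aW: "V a * W a > 0" using pos V_pos by simp
    have "a \<le> c" using aW A_pos B_pos by (simp add: c_def)
    then have "V a - V a * W a * a \<le> V c - V a * W a * c"
    proof (rule DERIV_nonneg_imp_nondecreasing)
      fix x assume x: "a \<le> x" "x \<le> c"
      have "V a * W a \<le> V x * W x"
        using V_mono [of a x] W_mono [of x] pos [of a] V_pos [of x] x by (intro mult_mono) auto
      moreover have "((\<lambda>y. V y - V a * W a * y) has_real_derivative V x * W x - V a * W a) (at x)"
        by (auto intro!: derivative_eq_intros deriv_V)
      ultimately show "\<exists>d. ((\<lambda>y. V y - V a * W a * y) has_real_derivative d) (at x) \<and> 0 \<le> d"
        by force
    qed
    moreover have "V a * W a * (c - a) = 1 + A / B"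
      using pos [of a] by (auto simp: c_def)
    ultimately have Vc: "V c > 1 + A / B"
      using V_pos [of a] by (simp add: algebra_simps)
    have "A / B > 0" using A_pos B_pos by simp
    have "A / B < V c ^ 1" using Vc by simp
    also have "\<dots> \<le> V c ^ 4"
      using Vc \<open>A / B > 0\<close> by (intro power_increasing) auto
    finally have "A < B * (V c) ^ 4"
      using B_pos by (simp add: field_simps)
    then have "A / (V c)\<^sup>2 < B * (V c)\<^sup>2"
      using V_pos [of c] by (simp add: pos_divide_less_eq power2_eq_square power4_eq_xxxx mult.assoc)
    then show False using False \<open>a \<le> c\<close> by force
  qed
qed

text \<open>Applying \<open>not_increasing\<close> to \<open>V\<close> and then to
  \<open>1 / V\<close> brackets a zero of \<open>W\<close> beyond \<open>a\<close>.\<close>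

lemma ex_critical_point: "\<exists>y\<ge>a. W y = 0"
proof -
  obtain b where b: "b \<ge> a" "W b \<le> 0"
    using not_increasing by blast
  interpret inv: sinh_gordon "\<lambda>y. 1 / V y" "\<lambda>y. - W y" B A
    by (rule inverse_solution)
  obtain c where c: "c \<ge> b" "W c \<ge> 0"
    using inv.not_increasing [of b] by auto
  have "\<exists>x\<ge>b. x \<le> c \<and> W x = 0"
    using IVT [of W b 0 c] b c DERIV_isCont [OF deriv_W] by blast
  then show ?thesis using b by (meson order_trans)
qed

section \<open>First integral and uniform bounds\<close>

definition "energy = (W 0)\<^sup>2 + A / (V 0)\<^sup>2 + B * (V 0)\<^sup>2"

lemma energy: "(W y)\<^sup>2 + A / (V y)\<^sup>2 + B * (V y)\<^sup>2 = energy"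
proof -
  have "((\<lambda>y. (W y)\<^sup>2 + A / (V y)\<^sup>2 + B * (V y)\<^sup>2) has_real_derivative 0) (at y)" for y
    by (auto intro!: derivative_eq_intros deriv_V deriv_W simp: field_simps power2_eq_square)
  then show ?thesis
    unfolding energy_def by (rule DERIV_isconst_all [rule_format, rotated])
qed

lemma energy_pos: "energy > 0"
  unfolding energy_def using A_pos B_pos
  by (intro add_pos_pos add_nonneg_pos) auto

lemma bounds: "\<exists>K>0. \<forall>y. V y \<le> K \<and> 1 / V y \<le> K \<and> \<bar>W y\<bar> \<le> K"
proof (intro exI conjI allI)
  define K where "K = sqrt energy + sqrt (energy / A) + sqrt (energy / B)"
  show "K > 0" unfolding K_def using energy_pos A_pos B_pos by (intro add_pos_pos) auto
  have nonneg: "sqrt energy \<ge> 0" "sqrt (energy / A) \<ge> 0" "sqrt (energy / B) \<ge> 0"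
    using energy_pos A_pos B_pos by auto
  fix y
  have pos: "A / (V y)\<^sup>2 \<ge> 0" "B * (V y)\<^sup>2 \<ge> 0" using A_pos B_pos by auto
  have "B * (V y)\<^sup>2 \<le> energy" "A / (V y)\<^sup>2 \<le> energy"
    using energy [of y] pos zero_le_power2 [of "W y"] by linarith+
  note le = this
  have "(V y)\<^sup>2 \<le> energy / B"
    using le B_pos by (simp add: field_simps)
  then show "V y \<le> K" using nonneg unfolding K_def by (smt (verit) real_le_rsqrt)
  have "(1 / V y)\<^sup>2 \<le> energy / A"
    using le A_pos by (simp add: field_simps)
  then show "1 / V y \<le> K" using nonneg unfolding K_def by (smt (verit) real_le_rsqrt)
  have "\<bar>W y\<bar>\<^sup>2 \<le> energy"
    using energy [of y] pos by simp
  then show "\<bar>W y\<bar> \<le> K" using nonneg unfolding K_def by (smt (verit) real_le_rsqrt)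
qed

text \<open>The reflected pair \<open>(V', W')\<close> solves the same system and agrees with
  \<open>(V, W)\<close> at the critical point \<open>c\<close>. On the range given by
  \<open>bounds\<close> the system is Lipschitz, so the squared distance \<open>D\<close> of the two
  solutions falls under \<open>gronwall_zero\<close>.\<close>

lemma reflection:
  assumes "W c = 0"
  shows "V (2 * c - y) = V y"
proof -
  obtain K where K: "K > 0" "\<And>y. V y \<le> K" "\<And>y. 1 / V y \<le> K" "\<And>y. \<bar>W y\<bar> \<le> K"
    using bounds by blast
  define V' where "V' y = V (2 * c - y)" for y
  define W' where "W' y = - W (2 * c - y)" for y
  have V'_pos: "V' y > 0" for y by (simp add: V'_def V_pos)
  have K': "V' y \<le> K" "1 / V' y \<le> K" "\<bar>W' y\<bar> \<le> K" for y
    using K by (simp_all add: V'_def W'_def)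
  have "((\<lambda>y. 2 * c - y) has_real_derivative - 1) (at y)" for y
    by (auto intro!: derivative_eq_intros)
  note comp = DERIV_chain2 [OF _ this]
  have derivs: "(V' has_real_derivative V' y * W' y) (at y)"
     "(W' has_real_derivative A / (V' y)\<^sup>2 - B * (V' y)\<^sup>2) (at y)" for y
    unfolding V'_def [abs_def] W'_def [abs_def]
    using comp [OF deriv_V] DERIV_minus [OF comp [OF deriv_W]] by simp_all
  define D where "D y = (V y - V' y)\<^sup>2 + (W y - W' y)\<^sup>2" for y
  \<comment> \<open>\<open>- G\<close> is the difference quotient of \<open>A / V^2 - B V^2\<close>
    as a function of \<open>V\<close>, between \<open>V y\<close> and \<open>V' y\<close>.\<close>
  define G where "G y = (V y + V' y) * (A * (1 / V y)\<^sup>2 * (1 / V' y)\<^sup>2 + B)" for y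
  \<comment> \<open>Of \<open>3 * K\<close>, one \<open>K\<close> bounds the factor \<open>V\<close>
    of a mixed term and \<open>2 * K\<close> bounds \<open>2 W'\<close>; the last summand bounds
    \<open>G\<close>.\<close>
  define C where "C = 3 * K + 2 * K * (A * K\<^sup>2 * K\<^sup>2 + B)"
  have "(D has_real_derivative 2 * (V y - V' y) * (V y * W y - V' y * W' y)
      + 2 * (W y - W' y) * (- G y * (V y - V' y))) (at y)" for y
  proof -
    have "A / (V y)\<^sup>2 - B * (V y)\<^sup>2 - (A / (V' y)\<^sup>2 - B * (V' y)\<^sup>2) = - G y * (V y - V' y)"
      using V_pos [of y] V'_pos [of y] by (simp add: G_def field_simps power2_eq_square)
    moreover have "(D has_real_derivative 2 * (V y - V' y) * (V y * W y - V' y * W' y)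
        + 2 * (W y - W' y) * (A / (V y)\<^sup>2 - B * (V y)\<^sup>2 - (A / (V' y)\<^sup>2 - B * (V' y)\<^sup>2))) (at y)"
      unfolding D_def [abs_def]
      by (rule derivative_eq_intros deriv_V deriv_W derivs refl)+ (simp add: algebra_simps diff_divide_distrib)
    ultimately show ?thesis by simp
  qed
  moreover have "\<bar>2 * (V y - V' y) * (V y * W y - V' y * W' y)
      + 2 * (W y - W' y) * (- G y * (V y - V' y))\<bar> \<le> C * D y" for y
  proof -
    define x where "x = V y - V' y"
    define w where "w = W y - W' y"
    have xw: "2 * \<bar>x\<bar> * \<bar>w\<bar> \<le> x\<^sup>2 + w\<^sup>2"
      using sum_squares_bound [of "\<bar>x\<bar>" "\<bar>w\<bar>"] by simp
    have sq: "(1 / V y)\<^sup>2 \<le> K\<^sup>2" "(1 / V' y)\<^sup>2 \<le> K\<^sup>2"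
      using K K' V_pos [of y] V'_pos [of y] by (intro power_mono; simp)+
    have G0: "G y \<ge> 0"
      unfolding G_def using V_pos [of y] V'_pos [of y] A_pos B_pos by (intro mult_nonneg_nonneg) auto
    have "A * (1 / V y)\<^sup>2 * (1 / V' y)\<^sup>2 \<le> A * K\<^sup>2 * K\<^sup>2"
      using sq A_pos by (intro mult_mono) auto
    then have G: "G y \<le> 2 * K * (A * K\<^sup>2 * K\<^sup>2 + B)"
      unfolding G_def using K(2) [of y] K'(1) [of y] V_pos [of y] V'_pos [of y] A_pos B_pos
      by (intro mult_mono) auto
    have "V y * W y - V' y * W' y = V y * w + W' y * x"
      by (simp add: x_def w_def algebra_simps)
    then have "2 * x * (V y * W y - V' y * W' y) + 2 * w * (- G y * x)
        = V y * (2 * x * w) + 2 * W' y * x\<^sup>2 - G y * (2 * x * w)"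
      by (simp add: algebra_simps power2_eq_square)
    also have "\<bar>\<dots>\<bar> \<le> \<bar>V y * (2 * x * w)\<bar> + \<bar>2 * W' y * x\<^sup>2\<bar> + \<bar>G y * (2 * x * w)\<bar>"
      by linarith
    also have "\<dots> = V y * (2 * \<bar>x\<bar> * \<bar>w\<bar>) + 2 * \<bar>W' y\<bar> * x\<^sup>2 + G y * (2 * \<bar>x\<bar> * \<bar>w\<bar>)"
      using V_pos [of y] G0 by (simp add: abs_mult)
    also have "\<dots> \<le> K * (x\<^sup>2 + w\<^sup>2) + 2 * K * (x\<^sup>2 + w\<^sup>2) + 2 * K * (A * K\<^sup>2 * K\<^sup>2 + B) * (x\<^sup>2 + w\<^sup>2)"
      using K K' [of y] V_pos [of y] G G0 xw A_pos B_pos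
      by (intro add_mono mult_mono) auto
    also have "\<dots> = C * D y"
      by (simp add: C_def D_def x_def w_def algebra_simps)
    finally show ?thesis by (simp add: x_def w_def)
  qed
  moreover have "D y \<ge> 0" "D c = 0" for y
    using assms by (simp_all add: D_def V'_def W'_def)
  ultimately have "D y = 0"
    by (rule gronwall_zero)
  then show ?thesis
    by (simp add: D_def V'_def sum_power2_eq_zero_iff)
qed

text \<open>Two reflections compose to a translation by twice the distance of their centres; centres
  at distance at least one make it nontrivial.\<close>

lemma periodic: "\<exists>T>0. \<forall>y. V (y + T) = V y"
proof -
  obtain a where a: "W a = 0" using ex_critical_point by blast
  obtain b where b: "W b = 0" "b \<ge> a + 1" using ex_critical_point by blast
  have "V (y + 2 * (b - a)) = V y" for y
    using reflection [OF b(1), of "2 * a - y"] reflection [OF a, of y]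
    by (simp add: algebra_simps)
  then show ?thesis using b by (intro exI [of _ "2 * (b - a)"]) auto
qed

end

subsection \<open>Screw motions\<close>

lemma cross3_cross3_unit:
  assumes "norm u = 1" shows "cross3 u (cross3 u y) = (u \<bullet> y) *\<^sub>R u - y"
  using assms by (simp add: Lagrange norm_eq_1)

lemma screw_motion_compose:
  assumes u: "norm u = 1"
  shows "screw_motion_about p u s h (screw_motion_about p u t k x)
    = screw_motion_about p u (s + t) (h + k) x"
proof -
  define y where "y = x - p"
  have uu: "u \<bullet> u = 1" using u by (simp add: norm_eq_1)
  have screw: "screw_motion_about p u t k (p + y)
      = p + cos t *\<^sub>R y + sin t *\<^sub>R cross3 u y + ((1 - cos t) * (u \<bullet> y) + k) *\<^sub>R u" for t k y
    by (simp add: screw_motion_about_def rotation_about_def scaleR_add_left)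
  define y' where "y' = cos t *\<^sub>R y + sin t *\<^sub>R cross3 u y + ((1 - cos t) * (u \<bullet> y) + k) *\<^sub>R u"
  have 1: "u \<bullet> y' = u \<bullet> y + k"
    by (simp add: y'_def inner_add_right dot_cross_self uu algebra_simps)
  have 2: "cross3 u y' = cos t *\<^sub>R cross3 u y + sin t *\<^sub>R ((u \<bullet> y) *\<^sub>R u - y)"
    by (simp add: y'_def cross_add_right cross_mult_right cross3_cross3_unit [OF u])
  have "screw_motion_about p u s h (p + y') = screw_motion_about p u (s + t) (h + k) (p + y)"
    unfolding screw 1 2 unfolding y'_def
    by (simp add: vec_eq_iff cos_add sin_add algebra_simps)
  moreover have "screw_motion_about p u t k x = p + y'"
    using screw [of t k y] by (simp add: y_def y'_def add.assoc)
  ultimately show ?thesis by (simp add: y_def)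
qed

lemma screw_motion_group:
  assumes "norm u = 1"
  shows "one_parameter_group (\<lambda>s. screw_motion_about p u (a * s) (h * s))"
  unfolding one_parameter_group_def
proof (intro conjI allI)
  show "screw_motion_about p u (a * 0) (h * 0) = id"
    by (simp add: screw_motion_about_def rotation_about_def fun_eq_iff)
  show "screw_motion_about p u (a * (s + t)) (h * (s + t)) =
      screw_motion_about p u (a * s) (h * s) \<circ> screw_motion_about p u (a * t) (h * t)" for s t
    by (simp add: fun_eq_iff screw_motion_compose [OF assms] distrib_left)
  show "continuous_on UNIV (\<lambda>s. screw_motion_about p u (a * s) (h * s) x)" for x
    unfolding screw_motion_about_def rotation_about_def by (intro continuous_intros)
qed

lemma screw_motion_derivative:
  assumes u: "norm u = 1"
  shows "((\<lambda>s. screw_motion_about p u (a * s) (h * s) x) has_vector_derivative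
     a *\<^sub>R cross3 u (screw_motion_about p u (a * s) (h * s) x - p) + h *\<^sub>R u) (at s)"
proof -
  define y where "y = x - p"
  have screw: "screw_motion_about p u (a * s) (h * s) x = p + cos (a * s) *\<^sub>R y
      + sin (a * s) *\<^sub>R cross3 u y + ((1 - cos (a * s)) * (u \<bullet> y) + h * s) *\<^sub>R u" for s
    by (simp add: screw_motion_about_def rotation_about_def scaleR_add_left y_def)
  have deriv: "((\<lambda>s. screw_motion_about p u (a * s) (h * s) x) has_vector_derivative
      (- a * sin (a * s)) *\<^sub>R y + (a * cos (a * s)) *\<^sub>R cross3 u y
      + (a * sin (a * s) * (u \<bullet> y) + h) *\<^sub>R u) (at s)"
    unfolding screw
    by (auto intro!: derivative_eq_intros
        simp: has_real_derivative_iff_has_vector_derivative [symmetric] mult.commute)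
  have cross: "cross3 u (screw_motion_about p u (a * s) (h * s) x - p)
      = cos (a * s) *\<^sub>R cross3 u y + sin (a * s) *\<^sub>R ((u \<bullet> y) *\<^sub>R u - y)"
    unfolding screw by (simp add: cross_add_right cross_mult_right cross3_cross3_unit [OF u])
  have "(- a * sin (a * s)) *\<^sub>R y + (a * cos (a * s)) *\<^sub>R cross3 u y
      + (a * sin (a * s) * (u \<bullet> y) + h) *\<^sub>R u
      = a *\<^sub>R cross3 u (screw_motion_about p u (a * s) (h * s) x - p) + h *\<^sub>R u"
    unfolding cross by (simp add: algebra_simps)
  with deriv show ?thesis by (simp only:)
qed

text \<open>The velocity is orthogonal to \<open>D\<close>, so the length of \<open>D\<close> is
  conserved. This serves as the uniqueness theorem for screw flows.\<close>

lemma rotation_ode_zero: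
  fixes D :: "real \<Rightarrow> real^3"
  assumes D: "\<And>s. (D has_vector_derivative cross3 w (D s)) (at s)" and "D 0 = 0"
  shows "D s = 0"
proof -
  have "((\<lambda>s. D s \<bullet> D s) has_real_derivative 0) (at s)" for s
    using bounded_bilinear.has_vector_derivative [OF bounded_bilinear_inner D D]
    by (simp add: has_real_derivative_iff_has_vector_derivative dot_cross_self inner_commute)
  then have "D s \<bullet> D s = D 0 \<bullet> D 0"
    using DERIV_isconst_all by blast
  then show ?thesis using assms(2) by simp
qed

subsection \<open>Explicit screw symmetry\<close>

locale band_hopf = band_cmc +
  fixes Q :: complex
  assumes hopf: "hopf f z = Q"
begin

lemma L_eq: "L z = H * (V (Im z))\<^sup>2 + 2 * Re Q"
  and P_eq: "P z = H * (V (Im z))\<^sup>2 - 2 * Re Q"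
  and M_eq: "M z = - 2 * Im Q"
  using hopf [of z] mean_curvature_LP [of z] by (auto simp: hopf_eq complex_eq_iff)

text \<open>The phase of \<open>Q\<close> cancels in \<open>L P - M^2 = H^2 V^4 - 4 |Q|^2\<close>,
  so the equation for \<open>V\<close> is common to the whole associated family.\<close>

lemma deriv_W:
  "(W has_real_derivative 4 * (cmod Q)\<^sup>2 / (V y)\<^sup>2 - H\<^sup>2 * (V y)\<^sup>2) (at y)"
proof -
  have "(W has_real_derivative ((M (Complex 0 y))\<^sup>2 - L (Complex 0 y) * P (Complex 0 y)) / (V y)\<^sup>2) (at y)"
    using gauss [of "Complex 0 y"] by simp
  moreover have "(M (Complex 0 y))\<^sup>2 - L (Complex 0 y) * P (Complex 0 y)
      = 4 * (cmod Q)\<^sup>2 - H\<^sup>2 * (V y)\<^sup>2 * (V y)\<^sup>2"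
    by (simp add: L_eq P_eq M_eq cmod_power2) (simp add: algebra_simps power2_eq_square)
  ultimately show ?thesis
    by (simp add: diff_divide_distrib)
qed

lemma sinh_gordon: "Q \<noteq> 0 \<Longrightarrow> sinh_gordon V W (4 * (cmod Q)\<^sup>2) (H\<^sup>2)"
  by unfold_locales (use V_pos H_nonzero deriv_V deriv_W in auto)

definition "Omega z = (1 / (V (Im z))\<^sup>2) *\<^sub>R (M z *\<^sub>R fx z - L z *\<^sub>R fy z) - W (Im z) *\<^sub>R N z"

definition "\<omega> = Omega 0"

text \<open>This is where the Gauss and Codazzi equations enter: they make the angular velocity
  \<open>\<omega>\<close> of the screw motion group constant.\<close>

lemma Omega_eq: "Omega z = \<omega>"
proof -
  have "has_partials Omega 0 0 z" for z
  proof -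
    define l where "l y = H * (V y)\<^sup>2 + 2 * Re Q" for y
    define m where "m = - 2 * Im Q"
    have l: "(l has_real_derivative (L z + P z) * W (Im z)) (at (Im z))" for z
      unfolding l_def [abs_def] mean_curvature_LP
      using DERIV_add [OF DERIV_cmult [OF deriv_V2, of H "Im z"] DERIV_const [of "2 * Re Q"]]
      by (simp add: algebra_simps)
    have L: "L = (\<lambda>z. l (Im z))" and M: "M = (\<lambda>z. m)"
      by (auto simp: l_def m_def L_eq M_eq)
    have "has_partials (\<lambda>z. 1 / (V (Im z))\<^sup>2) 0 (- 2 * W (Im z) / (V (Im z))\<^sup>2) z"
      by (rule has_partials_of_Im)
         (auto intro!: derivative_eq_intros deriv_V simp: field_simps power2_eq_square)
    note 1 = has_partials_diff [OF
        has_partials_scaleR [OF this has_partials_diff [OF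
          has_partials_linear [OF bounded_linear_scaleR_right [of m] partials(2)]
          has_partials_scaleR [OF has_partials_of_Im [OF l] partials(3)]]]
        has_partials_scaleR [OF has_partials_of_Im [OF gauss] partials_N]]
    show ?thesis
      unfolding Omega_def [abs_def] L M
      by (rule has_partials_cong [OF 1])
         (simp_all add: structure_equations Nx_def Ny_def L M vec_eq_iff field_simps power2_eq_square)
  qed
  then show ?thesis
    unfolding \<omega>_def by (rule has_partials_zero_const)
qed

text \<open>The tangent vectors turn with angular velocity \<open>\<omega>\<close> as
  \<open>x\<close> varies. Together the two identities say that
  \<open>fx - cross3 \<omega> f\<close> has vanishing partial derivatives, whence
  \<open>fx_eq\<close>.\<close>

lemma omega_cross: "cross3 \<omega> (fx z) = dx fx z" "cross3 \<omega> (fy z) = dy fx z"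
proof -
  have neg: "cross3 (fy z) (fx z) = - ((V (Im z))\<^sup>2 *\<^sub>R N z)" "cross3 (N z) (fy z) = - fx z"
    using frame(4,5) [of z] cross_skew by metis+
  show "cross3 \<omega> (fx z) = dx fx z" "cross3 \<omega> (fy z) = dy fx z"
    unfolding Omega_eq [of z, symmetric] Omega_def structure_equations
    by (simp_all add: Cross3.left_diff_distrib cross_mult_left neg frame(4,6))
qed

lemma omega_inner: "\<omega> \<bullet> fx z = M z" "\<omega> \<bullet> fy z = - L z"
  and omega_norm: "(V (Im z))\<^sup>2 * (\<omega> \<bullet> \<omega>) = (M z)\<^sup>2 + (L z)\<^sup>2 + (V (Im z))\<^sup>2 * (W (Im z))\<^sup>2"
proof -
  show "\<omega> \<bullet> fx z = M z" "\<omega> \<bullet> fy z = - L z"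
    unfolding Omega_eq [of z, symmetric] Omega_def
    by (simp_all add: inner_diff_left inner_frame)
  show "(V (Im z))\<^sup>2 * (\<omega> \<bullet> \<omega>) = (M z)\<^sup>2 + (L z)\<^sup>2 + (V (Im z))\<^sup>2 * (W (Im z))\<^sup>2"
    unfolding Omega_eq [of z, symmetric] Omega_def
    by (simp add: inner_diff_left inner_diff_right inner_frame algebra_simps)
       (simp add: power2_eq_square field_simps)
qed

definition "\<tau> = fx 0 - cross3 \<omega> (f 0)"

lemma fx_eq: "fx z = cross3 \<omega> (f z) + \<tau>"
proof -
  have "has_partials (\<lambda>z. fx z - cross3 \<omega> (f z)) 0 0 z" for z
    using has_partials_diff [OF partials(2) has_partials_cross3 [OF has_partials_const partials(1)], of \<omega> z]
    by (simp add: omega_cross)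
  from has_partials_zero_const [OF this, of z 0] show ?thesis
    by (simp add: \<tau>_def algebra_simps)
qed

end

text \<open>A nonvanishing \<open>L\<close> yields a nonzero angular velocity and, by
  \<open>V2_h2\<close>, keeps the surface off the screw axis, so that an angle about the axis makes
  sense.\<close>

locale band_screw = band_hopf +
  assumes L_nonzero: "L z \<noteq> 0"
begin

definition "a = norm \<omega>"
definition "h = - 2 * Im Q / a"
definition "u = (1 / a) *\<^sub>R \<omega>"
text \<open>A point of the screw axis: there the velocity field
  \<open>cross3 \<omega> x + \<tau>\<close> is parallel to \<open>\<omega>\<close>.\<close>

definition "p = (1 / a\<^sup>2) *\<^sub>R cross3 \<omega> \<tau>"

lemma a2_eq: "a\<^sup>2 = \<omega> \<bullet> \<omega>"
  by (simp add: a_def power2_norm_eq_inner)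

lemma a_pos: "a > 0"
proof -
  have "(V (Im 0))\<^sup>2 * (\<omega> \<bullet> \<omega>) > 0"
    unfolding omega_norm using L_nonzero [of 0]
    by (intro add_pos_nonneg add_nonneg_pos) auto
  then have "\<omega> \<noteq> 0" by auto
  then show ?thesis by (simp add: a_def)
qed

lemma norm_u: "norm u = 1"
  using a_pos by (simp add: u_def) (simp add: a_def)

lemma omega_eq: "\<omega> = a *\<^sub>R u"
  using a_pos by (simp add: u_def)

lemma h_eq: "h = M z / a"
  by (simp add: h_def M_eq)

lemma u_inner: "u \<bullet> fx z = h" "u \<bullet> fy z = - L z / a"
  using omega_inner [of z] by (simp_all add: u_def h_eq [of z])

lemma fx_eq_screw: "fx z = a *\<^sub>R cross3 u (f z - p) + h *\<^sub>R u"
proof -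
  have "\<omega> \<bullet> \<tau> = M 0"
    using omega_inner(1) [of 0] by (simp add: fx_eq [of 0] inner_add_right dot_cross_self)
  then have "cross3 \<omega> p = (1 / a\<^sup>2) *\<^sub>R (M 0 *\<^sub>R \<omega> - a\<^sup>2 *\<^sub>R \<tau>)"
    by (simp add: p_def cross_mult_right Lagrange a2_eq)
  also have "\<dots> = h *\<^sub>R u - \<tau>"
    using a_pos by (simp add: h_eq [of 0] u_def scaleR_diff_right power2_eq_square)
  finally have "cross3 \<omega> p = h *\<^sub>R u - \<tau>" .
  then have "fx z = cross3 \<omega> (f z - p) + h *\<^sub>R u"
    by (simp add: fx_eq [of z] Cross3.right_diff_distrib)
  then show ?thesis
    by (simp add: omega_eq cross_mult_left)
qed

text \<open>Both sides are integral curves, starting at \<open>f z\<close>, of one affine velocity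
  field with linear part \<open>cross3 \<omega>\<close>; their difference is covered by
  \<open>rotation_ode_zero\<close>.\<close>

lemma screw_motion: "f (z + of_real s) = screw_motion_about p u (a * s) (h * s) (f z)"
proof -
  define D where "D s = f (z + of_real s) - screw_motion_about p u (a * s) (h * s) (f z)" for s
  have "(D has_vector_derivative cross3 \<omega> (D s)) (at s)" for s
  proof -
    have "(D has_vector_derivative fx (z + of_real s)
       - (a *\<^sub>R cross3 u (screw_motion_about p u (a * s) (h * s) (f z) - p) + h *\<^sub>R u)) (at s)"
      unfolding D_def [abs_def]
      by (intro has_vector_derivative_diff has_partials_horizontal [OF partials(1)]
          screw_motion_derivative norm_u)
    moreover have "fx (z + of_real s)
       - (a *\<^sub>R cross3 u (screw_motion_about p u (a * s) (h * s) (f z) - p) + h *\<^sub>R u) = cross3 \<omega> (D s)"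
      unfolding D_def omega_eq fx_eq_screw
      by (simp add: Cross3.right_diff_distrib cross_mult_left scaleR_diff_right)
    ultimately show ?thesis by simp
  qed
  moreover have "D 0 = 0"
    by (simp add: D_def screw_motion_about_def rotation_about_def)
  ultimately have "D s = 0" by (rule rotation_ode_zero)
  then show ?thesis by (simp add: D_def)
qed

lemma screw_motion_symmetric: "screw_motion_symmetric f"
  unfolding screw_motion_symmetric_def nontrivial_screw_group_def
proof (rule exI, intro conjI)
  let ?S = "\<lambda>s. screw_motion_about p u (a * s) (h * s)"
  show "one_parameter_group ?S"
    by (rule screw_motion_group [OF norm_u])
  show "\<forall>s z. f (z + of_real s) = ?S s (f z)"
    by (simp add: screw_motion)
  show "\<exists>p u. norm u = 1 \<and> (\<forall>s. \<exists>t h. ?S s = screw_motion_about p u t h)"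
    using norm_u by blast
  show "\<exists>s. ?S s \<noteq> id"
  proof (rule ccontr)
    assume "\<nexists>s. ?S s \<noteq> id"
    then have "f (z + of_real s) = f z" for s z
      by (simp add: screw_motion)
    then have "((\<lambda>s. f (0 + of_real s)) has_vector_derivative 0) (at 0)"
      by (simp only: has_vector_derivative_const)
    moreover have "((\<lambda>s. f (0 + of_real s)) has_vector_derivative fx (0 + of_real 0)) (at 0)"
      by (rule has_partials_horizontal [OF partials(1)])
    ultimately have "fx 0 = 0"
      using vector_derivative_unique_at by fastforce
    then show False using fx_fx [of 0] by simp
  qed
qed

end

subsection \<open>The closing condition\<close>

context band_screw
begin

lemma V2_h2: "(V (Im z))\<^sup>2 - h\<^sup>2 = ((L z)\<^sup>2 + (V (Im z))\<^sup>2 * (W (Im z))\<^sup>2) / a\<^sup>2"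
  using a_pos omega_norm [of z] by (simp add: h_eq [of z] field_simps a2_eq [symmetric])

lemma V2_h2_pos: "(V y)\<^sup>2 - h\<^sup>2 > 0"
  using V2_h2 [of "Complex 0 y"] L_nonzero [of "Complex 0 y"] a_pos
  by (auto intro!: divide_pos_pos add_pos_nonneg)

text \<open>The length of the part of \<open>fx\<close> orthogonal to the axis, that is,
  \<open>a\<close> times the distance from the axis.\<close>

definition "\<rho> y = sqrt ((V y)\<^sup>2 - h\<^sup>2)"

lemma \<rho>_pos: "\<rho> y > 0"
  using V2_h2_pos by (simp add: \<rho>_def)

lemma \<rho>_nz [simp]: "\<rho> y \<noteq> 0"
  using \<rho>_pos [of y] by simp

text \<open>The \<open>y\<close>-derivative of the angle about the axis.\<close>

definition "\<beta> y = h * (H * (V y)\<^sup>2 + 2 * Re Q) / ((V y)\<^sup>2 - h\<^sup>2)"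

text \<open>The unit vector in the circumferential direction about the axis.\<close>

definition "Z z = (1 / \<rho> (Im z)) *\<^sub>R (fx z - h *\<^sub>R u)"

lemma u_Z: "u \<bullet> Z z = 0"
  using norm_u by (simp add: Z_def inner_diff_right u_inner norm_eq_1)

lemma u_u_Z: "cross3 u (cross3 u (Z z)) = - Z z"
  by (simp add: cross3_cross3_unit [OF norm_u] u_Z)

text \<open>Splits the change of \<open>fx\<close> in \<open>y\<close> into a change of length
  orthogonal to the axis and a rotation about it. After multiplication by
  \<open>s = a^2 (V^2 - h^2)\<close>, the definition of \<open>\<omega>\<close> trades the term in
  \<open>N\<close> for \<open>\<omega>\<close>, \<open>fx\<close> and \<open>f_xx\<close>.\<close>

lemma mixed_derivative_rotating_frame:
  "((V (Im z))\<^sup>2 - h\<^sup>2) *\<^sub>R dy fx z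
     = (W (Im z) * (V (Im z))\<^sup>2) *\<^sub>R (fx z - h *\<^sub>R u) + (h * L z) *\<^sub>R cross3 u (fx z)"
proof -
  let ?v = "V (Im z)" and ?w = "W (Im z)"
  define s where "s = (L z)\<^sup>2 + ?v\<^sup>2 * ?w\<^sup>2"
  have av: "a\<^sup>2 * ?v\<^sup>2 = (M z)\<^sup>2 + s"
    using omega_norm [of z] by (simp add: s_def a2_eq mult.commute)
  have "?v\<^sup>2 *\<^sub>R \<omega> = M z *\<^sub>R fx z - L z *\<^sub>R fy z - (?v\<^sup>2 * ?w) *\<^sub>R N z"
    unfolding Omega_eq [of z, symmetric] Omega_def by (simp add: scaleR_diff_right)
  from arg_cong [OF this, of "\<lambda>x. (?w * M z) *\<^sub>R x"]
  have om: "(?v\<^sup>2 * ?w * M z) *\<^sub>R \<omega>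
      = (?w * (M z)\<^sup>2) *\<^sub>R fx z - (?w * M z * L z) *\<^sub>R fy z - (?v\<^sup>2 * ?w\<^sup>2 * M z) *\<^sub>R N z"
    by (simp add: scaleR_diff_right power2_eq_square mult.assoc mult.left_commute mult.commute)
  have "s *\<^sub>R dy fx z = (?w * s) *\<^sub>R fx z + (s * M z) *\<^sub>R N z"
    by (simp add: structure_equations algebra_simps)
  also have "\<dots> = (?w * (a\<^sup>2 * ?v\<^sup>2)) *\<^sub>R fx z - (?v\<^sup>2 * ?w * M z) *\<^sub>R \<omega> + (M z * L z) *\<^sub>R dx fx z"
    unfolding om av structure_equations s_def by (simp add: algebra_simps power2_eq_square)
  finally have eq: "s *\<^sub>R dy fx z
    = (?w * (a\<^sup>2 * ?v\<^sup>2)) *\<^sub>R fx z - (?v\<^sup>2 * ?w * M z) *\<^sub>R \<omega> + (M z * L z) *\<^sub>R dx fx z" .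
  have "dx fx z = a *\<^sub>R cross3 u (fx z)"
    using omega_cross(1) [of z] by (simp add: omega_eq cross_mult_left)
  then have "a\<^sup>2 *\<^sub>R (((V (Im z))\<^sup>2 - h\<^sup>2) *\<^sub>R dy fx z)
     = a\<^sup>2 *\<^sub>R ((?w * ?v\<^sup>2) *\<^sub>R (fx z - h *\<^sub>R u) + (h * L z) *\<^sub>R cross3 u (fx z))"
    using eq a_pos unfolding V2_h2 s_def [symmetric]
    by (simp add: h_eq [of z] u_def algebra_simps power2_eq_square)
  then show ?thesis
    unfolding scaleR_cancel_left using a_pos by simp
qed

lemma deriv_\<rho>: "((\<lambda>y. 1 / \<rho> y) has_real_derivative - (V y)\<^sup>2 * W y / ((V y)\<^sup>2 - h\<^sup>2) * (1 / \<rho> y)) (at y)"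
proof -
  have "((\<lambda>y. (V y)\<^sup>2 - h\<^sup>2) has_real_derivative 2 * (V y)\<^sup>2 * W y) (at y)"
    using DERIV_diff [OF deriv_V2 DERIV_const] by simp
  from DERIV_chain2 [OF DERIV_real_sqrt [OF V2_h2_pos] this]
  have "(\<rho> has_real_derivative inverse (\<rho> y) / 2 * (2 * (V y)\<^sup>2 * W y)) (at y)"
    by (simp only: \<rho>_def [abs_def])
  then have "(\<rho> has_real_derivative (V y)\<^sup>2 * W y / \<rho> y) (at y)"
    by (rule DERIV_cong) (simp add: field_simps)
  from DERIV_divide [OF DERIV_const this, of 1]
  have "((\<lambda>y. 1 / \<rho> y) has_real_derivative - ((V y)\<^sup>2 * W y / \<rho> y) / (\<rho> y * \<rho> y)) (at y)"
    by simp
  moreover have "\<rho> y * \<rho> y = (V y)\<^sup>2 - h\<^sup>2"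
    using V2_h2_pos [of y] by (simp add: \<rho>_def)
  ultimately show ?thesis by (simp add: mult.commute)
qed

text \<open>The change of length of \<open>fx - h u\<close> cancels against that of
  \<open>\<rho>\<close>; what remains is rotation about \<open>u\<close>, at the rates
  \<open>a\<close> in \<open>x\<close> and \<open>\<beta>\<close> in \<open>y\<close>.\<close>

lemma partials_Z: "has_partials Z (a *\<^sub>R cross3 u (Z z)) (\<beta> (Im z) *\<^sub>R cross3 u (Z z)) z"
proof -
  let ?v = "V (Im z)" and ?r = "1 / \<rho> (Im z)" and ?d = "(V (Im z))\<^sup>2 - h\<^sup>2"
  have d: "?d \<noteq> 0" using V2_h2_pos [of "Im z"] by simp
  have uZ: "cross3 u (Z z) = ?r *\<^sub>R cross3 u (fx z)"
    by (simp add: Z_def cross_mult_right Cross3.right_diff_distrib)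
  have dyfx: "dy fx z = (?v\<^sup>2 * W (Im z) / ?d) *\<^sub>R (fx z - h *\<^sub>R u) + \<beta> (Im z) *\<^sub>R cross3 u (fx z)"
  proof -
    have "dy fx z = (1 / ?d) *\<^sub>R (?d *\<^sub>R dy fx z)" using d by simp
    also have "\<dots> = (?v\<^sup>2 * W (Im z) / ?d) *\<^sub>R (fx z - h *\<^sub>R u) + \<beta> (Im z) *\<^sub>R cross3 u (fx z)"
      unfolding mixed_derivative_rotating_frame
      by (simp add: scaleR_add_right \<beta>_def L_eq mult.commute)
    finally show ?thesis .
  qed
  have dxfx: "dx fx z = a *\<^sub>R cross3 u (fx z)"
    using omega_cross(1) [of z] by (simp add: omega_eq cross_mult_left)
  show ?thesis
    unfolding Z_def [abs_def]
  proof (rule has_partials_cong)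
    show "has_partials (\<lambda>z. (1 / \<rho> (Im z)) *\<^sub>R (fx z - h *\<^sub>R u))
      (0 *\<^sub>R (fx z - h *\<^sub>R u) + ?r *\<^sub>R (dx fx z - 0))
      ((- ?v\<^sup>2 * W (Im z) / ?d * ?r) *\<^sub>R (fx z - h *\<^sub>R u) + ?r *\<^sub>R (dy fx z - 0)) z"
      by (intro has_partials_scaleR has_partials_diff has_partials_of_Im has_partials_const
          partials deriv_\<rho>)
    show "0 *\<^sub>R (fx z - h *\<^sub>R u) + ?r *\<^sub>R (dx fx z - 0)
        = a *\<^sub>R cross3 u (?r *\<^sub>R (fx z - h *\<^sub>R u))"
      using uZ unfolding Z_def by (simp add: dxfx)
    show "(- ?v\<^sup>2 * W (Im z) / ?d * ?r) *\<^sub>R (fx z - h *\<^sub>R u) + ?r *\<^sub>R (dy fx z - 0)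
        = \<beta> (Im z) *\<^sub>R cross3 u (?r *\<^sub>R (fx z - h *\<^sub>R u))"
      using uZ unfolding Z_def by (simp add: dyfx algebra_simps)
  qed
qed

text \<open>\<open>height\<close> closes the coordinate along the axis. \<open>angle\<close> makes
  \<open>fx\<close> periodic, and as \<open>fx\<close> determines \<open>f\<close> up to a
  displacement along the axis, the two together close \<open>f\<close>.\<close>

lemma closing_condition:
  fixes G1 G2 :: "real \<Rightarrow> real" and n :: int
  assumes G1: "\<And>y. (G1 has_real_derivative H * (V y)\<^sup>2 + 2 * Re Q) (at y)"
    and G2: "\<And>y. (G2 has_real_derivative \<beta> y) (at y)"
    and T: "\<And>y. V (y + T) = V y"
    and height: "a * h * s = G1 T - G1 0"
    and angle: "a * s + G2 T - G2 0 = 2 * pi * of_int n"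
  shows "f (z + Complex s T) = f z"
proof -
  have shift: "G (y + T) - G y = G T - G 0"
    if G: "\<And>y. (G has_real_derivative g y) (at y)" and g: "\<And>y. g (y + T) = g y"
    for G g :: "real \<Rightarrow> real" and y
  proof -
    have "((\<lambda>y. y + T) has_real_derivative 1) (at y)" for y
      by (auto intro!: derivative_eq_intros)
    from DERIV_diff [OF DERIV_chain2 [OF G this] G]
    have "((\<lambda>y. G (y + T) - G y) has_real_derivative 0) (at y)" for y
      by (simp add: g)
    from DERIV_isconst_all [OF allI [OF this], of y 0] show ?thesis by simp
  qed
  have shift1: "G1 (y + T) - G1 y = G1 T - G1 0" for y
    by (rule shift [OF G1]) (simp add: T)
  have shift2: "G2 (y + T) - G2 y = G2 T - G2 0" for y
    by (rule shift [OF G2]) (simp add: \<beta>_def T)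
  have axial: "u \<bullet> f (z + Complex s T) = u \<bullet> f z" for z
  proof -
    have "has_partials (\<lambda>z. u \<bullet> f z - h * Re z + 1 / a * G1 (Im z)) 0 0 z" for z
      by (rule has_partials_cong [OF has_partials_add [OF has_partials_diff [OF
              has_partials_linear [OF bounded_linear_inner_right partials(1)]
              has_partials_linear [OF bounded_linear_mult_right has_partials_Re]]
              has_partials_linear [OF bounded_linear_mult_right has_partials_of_Im [OF G1]]]])
         (simp_all add: u_inner L_eq add_divide_distrib [symmetric])
    from has_partials_zero_const [OF this, of "z + Complex s T" z]
    have "u \<bullet> f (z + Complex s T) - u \<bullet> f z = h * s - 1 / a * (G1 (Im z + T) - G1 (Im z))"
      by (simp add: algebra_simps)
    also have "\<dots> = 0"
      using a_pos unfolding shift1 height [symmetric] by simp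
    finally show ?thesis by simp
  qed
  define \<phi> where "\<phi> z = a * Re z + G2 (Im z)" for z
  \<comment> \<open>\<open>Z\<close> turned back by the accumulated angle \<open>\<phi>\<close>; the
    rotation found in \<open>partials_Z\<close> is thereby undone and \<open>Y\<close> is
    constant.\<close>
  define Y where "Y z = cos (\<phi> z) *\<^sub>R Z z - sin (\<phi> z) *\<^sub>R cross3 u (Z z)" for z
  have partials_\<phi>: "has_partials \<phi> a (\<beta> (Im z)) z" for z
    unfolding \<phi>_def [abs_def]
    by (rule has_partials_cong [OF has_partials_add [OF
            has_partials_linear [OF bounded_linear_mult_right has_partials_Re] has_partials_of_Im [OF G2]]])
       simp_all
  have "has_partials Y 0 0 z" for z
    unfolding Y_def [abs_def]
    by (rule has_partials_cong [OF has_partials_diff [OF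
            has_partials_scaleR [OF has_partials_chain [OF partials_\<phi> DERIV_cos] partials_Z]
            has_partials_scaleR [OF has_partials_chain [OF partials_\<phi> DERIV_sin]
              has_partials_cross3 [OF has_partials_const partials_Z]]]])
       (simp_all add: cross_mult_right u_u_Z algebra_simps)
  then have Y: "Y z = Y w" for z w
    by (rule has_partials_zero_const)
  have Z_Y: "Z z = cos (\<phi> z) *\<^sub>R Y z + sin (\<phi> z) *\<^sub>R cross3 u (Y z)" for z
  proof -
    have "cos (\<phi> z) *\<^sub>R Y z + sin (\<phi> z) *\<^sub>R cross3 u (Y z)
        = (cos (\<phi> z) * cos (\<phi> z)) *\<^sub>R Z z + (sin (\<phi> z) * sin (\<phi> z)) *\<^sub>R Z z"
      unfolding Y_def
      by (simp add: Cross3.right_diff_distrib cross_mult_right u_u_Z algebra_simps)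
    then show ?thesis by (simp add: scaleR_add_left [symmetric])
  qed
  have fx: "fx (z + Complex s T) = fx z" for z
  proof -
    have \<phi>: "\<phi> (z + Complex s T) = \<phi> z + of_int n * (2 * pi)"
      using angle shift2 [of "Im z"] by (simp add: \<phi>_def algebra_simps)
    have "sin (\<phi> z + of_int n * (2 * pi)) = sin (\<phi> z)" "cos (\<phi> z + of_int n * (2 * pi)) = cos (\<phi> z)"
      by (simp_all add: sin_add cos_add mult.commute [of _ "2 * pi"])
    then have "Z (z + Complex s T) = Z z"
      unfolding Z_Y [of "z + Complex s T"] Z_Y [of z] \<phi> Y [of "z + Complex s T" z] by simp
    then show ?thesis
      using V2_h2_pos [of "Im z"] by (simp add: Z_def \<rho>_def T)
  qed
  define D where "D = f (z + Complex s T) - f z"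
  have "cross3 \<omega> D = 0"
    using fx [of z] by (simp add: D_def fx_eq Cross3.right_diff_distrib)
  then have "cross3 u D = cross3 u 0"
    by (simp add: u_def cross_mult_left)
  moreover have "u \<bullet> D = u \<bullet> 0"
    by (simp add: D_def inner_diff_right axial)
  moreover have "u \<noteq> 0" using norm_u by auto
  ultimately have "D = 0" by (metis cross_dot_cancel)
  then show ?thesis by (simp add: D_def)
qed

end

subsection \<open>Isometries of space\<close>

lemma isometry_affine:
  fixes R :: "'a::euclidean_space \<Rightarrow> 'a"
  assumes "\<And>x y. dist (R x) (R y) = dist x y"
  obtains A where "orthogonal_transformation A" "\<And>x. R x = R 0 + A x"
proof
  show "orthogonal_transformation (\<lambda>x. R x - R 0)"
    unfolding orthogonal_transformation_isometry using assms by (simp add: dist_norm)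
qed simp

lemma rotation_about_isometry:
  assumes u: "norm u = 1"
  shows "dist (rotation_about p u t x) (rotation_about p u t y) = dist x y"
proof -
  define d where "d = x - y"
  have "rotation_about p u t x - rotation_about p u t y
      = cos t *\<^sub>R d + sin t *\<^sub>R cross3 u d + ((1 - cos t) * (u \<bullet> d)) *\<^sub>R u"
    unfolding rotation_about_def d_def
    by (simp add: Cross3.right_diff_distrib inner_diff_right algebra_simps)
  moreover have "(norm (cos t *\<^sub>R d + sin t *\<^sub>R cross3 u d + ((1 - cos t) * (u \<bullet> d)) *\<^sub>R u))\<^sup>2 = (norm d)\<^sup>2"
  proof -
    have uu: "u \<bullet> u = 1" using u by (simp add: norm_eq_1)
    have cc: "cross3 u d \<bullet> cross3 u d = d \<bullet> d - (u \<bullet> d)\<^sup>2"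
      using norm_cross_dot [of u d] u by (simp add: power2_norm_eq_inner)
    have "(norm (cos t *\<^sub>R d + sin t *\<^sub>R cross3 u d + ((1 - cos t) * (u \<bullet> d)) *\<^sub>R u))\<^sup>2
        = (cos t)\<^sup>2 * (d \<bullet> d) + (sin t)\<^sup>2 * (cross3 u d \<bullet> cross3 u d)
          + ((1 - cos t)\<^sup>2 + 2 * cos t * (1 - cos t)) * (u \<bullet> d)\<^sup>2"
      unfolding power2_norm_eq_inner
      by (simp add: inner_add_left inner_add_right uu dot_cross_self inner_commute [of d u]
          algebra_simps power2_eq_square)
    also have "\<dots> = d \<bullet> d"
      unfolding cc sin_squared_eq by (simp add: algebra_simps power2_eq_square)
    finally show ?thesis by (simp add: power2_norm_eq_inner)
  qed
  ultimately show ?thesis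
    by (simp add: dist_norm d_def)
qed

lemma infdist_line:
  fixes u :: "'a::real_inner"
  assumes u: "norm u = 1" and n: "u \<bullet> n = 0" "norm n = r"
  shows "infdist (p + t *\<^sub>R u + n) (range (\<lambda>t. p + t *\<^sub>R u)) = r"
proof (rule antisym)
  show "infdist (p + t *\<^sub>R u + n) (range (\<lambda>t. p + t *\<^sub>R u)) \<le> r"
    using infdist_le [of "p + t *\<^sub>R u" "range (\<lambda>t. p + t *\<^sub>R u)" "p + t *\<^sub>R u + n"]
      rangeI [of "\<lambda>t. p + t *\<^sub>R u" t] n
    by (simp add: dist_norm)
  have "r \<le> dist (p + t *\<^sub>R u + n) (p + s *\<^sub>R u)" for s
  proof -
    have "(dist (p + t *\<^sub>R u + n) (p + s *\<^sub>R u))\<^sup>2 = (norm ((t - s) *\<^sub>R u + n))\<^sup>2"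
      by (simp add: dist_norm algebra_simps)
    also have "\<dots> = (t - s)\<^sup>2 + r\<^sup>2"
      using u n unfolding n(2) [symmetric] power2_norm_eq_inner
      by (simp add: inner_add_left inner_add_right norm_eq_1 inner_commute [of n u] power2_eq_square)
    finally have "r\<^sup>2 \<le> (dist (p + t *\<^sub>R u + n) (p + s *\<^sub>R u))\<^sup>2" by simp
    then show ?thesis using power2_le_imp_le zero_le_dist by blast
  qed
  then show "r \<le> infdist (p + t *\<^sub>R u + n) (range (\<lambda>t. p + t *\<^sub>R u))"
    by (auto simp: infdist_def intro!: cINF_greatest)
qed

subsection \<open>Spheres and circular cylinders\<close>

text \<open>All points are umbilic: \<open>N_x = - H fx\<close> and \<open>N_y = - H fy\<close>, so
  the centre \<open>f + N / H\<close> does not move.\<close>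

lemma (in band_hopf) hopf_zero_sphere:
  assumes "Q = 0"
  shows "part_of_round_sphere f"
proof -
  have "has_partials (\<lambda>z. f z + (1 / H) *\<^sub>R N z) 0 0 z" for z
    by (rule has_partials_cong [OF has_partials_add [OF partials(1)
            has_partials_linear [OF bounded_linear_scaleR_right partials_N]]])
       (use H_nonzero assms in \<open>simp_all add: Nx_def Ny_def L_eq M_eq P_eq\<close>)
  then have const: "f z + (1 / H) *\<^sub>R N z = f 0 + (1 / H) *\<^sub>R N 0" for z
    by (rule has_partials_zero_const)
  define c where "c = f 0 + (1 / H) *\<^sub>R N 0"
  have "dist c (f z) = 1 / \<bar>H\<bar>" for z
  proof -
    have "c - f z = (1 / H) *\<^sub>R N z"
      using const [of z] by (simp add: c_def algebra_simps)
    then show ?thesis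
      by (simp add: dist_norm norm_eq_sqrt_inner [of "N z"] N_simps)
  qed
  then show ?thesis
    unfolding part_of_round_sphere_def using H_nonzero
    by (intro exI [of _ c] exI [of _ "1 / \<bar>H\<bar>"]) auto
qed

text \<open>The second fundamental form has constant coefficients and, by the Gauss equation,
  determinant zero. Its kernel is spanned by a constant vector, the direction of the axis, and
  \<open>f + N / (2 H)\<close> moves along the axis.\<close>

lemma (in band_hopf) constant_metric_cylinder:
  assumes V: "\<And>y. V y = V 0"
  shows "part_of_circular_cylinder f"
proof -
  have "V = (\<lambda>y. V 0)" using V by blast
  then have W0: "W y = 0" for y
    unfolding W_def by (metis DERIV_const DERIV_imp_deriv divide_eq_0_iff)
  then have "W = (\<lambda>y. 0)" by blast
  then have "((\<lambda>y. 0) has_real_derivative ((M 0)\<^sup>2 - L 0 * P 0) / (V (Im 0))\<^sup>2) (at (Im 0))"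
    using gauss [of 0] by simp
  from DERIV_unique [OF DERIV_const this]
  have LP0: "L 0 * P 0 = (M 0)\<^sup>2" by simp
  define v l m p where "v = (V 0)\<^sup>2" and "l = L 0" and "m = M 0" and "p = P 0"
  have V2: "(V y)\<^sup>2 = v" for y using V [of y] by (simp add: v_def)
  have v: "v > 0" by (simp add: v_def)
  have L: "L z = l" and M: "M z = m" and P: "P z = p" for z
    using V2 [of "Im z"] by (simp_all add: L_eq M_eq P_eq v_def l_def m_def p_def)
  have lp: "l * p = m * m" using LP0 by (simp add: l_def m_def p_def power2_eq_square)
  have sum: "l + p = 2 * H * v"
    using mean_curvature_LP [of 0] by (simp add: l_def p_def v_def)
  \<comment> \<open>The combinations with coefficients \<open>(p, - m)\<close> and
    \<open>(- m, l)\<close> both lie in the kernel, and one is nonzero because \<open>l + p\<close>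
    is. \<open>X\<close> stands for that one, and \<open>\<alpha>\<close>, \<open>\<beta>\<close>
    express both through it.\<close>
  have fin: ?thesis
    if X: "\<And>z. has_partials X 0 0 z" and Xne: "X 0 \<noteq> 0" and XN: "\<And>z. X z \<bullet> N z = 0"
      and par: "\<And>z. p *\<^sub>R fx z - m *\<^sub>R fy z = \<alpha> *\<^sub>R X z" "\<And>z. l *\<^sub>R fy z - m *\<^sub>R fx z = \<beta> *\<^sub>R X z"
    for X :: "complex \<Rightarrow> real^3" and \<alpha> \<beta>
  proof -
    have X0: "X z = X 0" for z using has_partials_zero_const [OF X] .
    define k where "k = 1 / (2 * H * v)"
    have k: "k * l + k * p = 1"
      using v H_nonzero sum by (simp add: k_def field_simps)
    define r where "r = norm (X 0)"
    have r: "r \<noteq> 0" using Xne by (simp add: r_def)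
    define U where "U = (1 / r) *\<^sub>R X 0"
    have U: "norm U = 1" "X 0 = r *\<^sub>R U"
      using r by (simp_all add: U_def r_def)
    define c where "c z = k * r * (\<alpha> * Re z + \<beta> * Im z)" for z
    have "has_partials (\<lambda>z. f z + (1 / (2 * H)) *\<^sub>R N z - c z *\<^sub>R U) 0 0 z" for z
    proof -
      have "has_partials c (k * r * (\<alpha> * 1 + \<beta> * 0)) (k * r * (\<alpha> * 0 + \<beta> * 1)) z"
        unfolding c_def [abs_def]
        by (intro has_partials_linear [OF bounded_linear_mult_right] has_partials_add
            has_partials_Re has_partials_Im)
      from has_partials_linear [OF bounded_linear_scaleR_left [of U] this]
      have c: "has_partials (\<lambda>z. c z *\<^sub>R U) (k *\<^sub>R \<alpha> *\<^sub>R X z) (k *\<^sub>R \<beta> *\<^sub>R X z) z"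
        by (simp add: X0 [of z] U(2) mult_ac)
      have "fx z + (1 / (2 * H)) *\<^sub>R Nx z = k *\<^sub>R \<alpha> *\<^sub>R X z"
      proof -
        have "fx z + (1 / (2 * H)) *\<^sub>R Nx z = (1 - k * l) *\<^sub>R fx z - (k * m) *\<^sub>R fy z"
          by (simp add: Nx_def L M V2 k_def algebra_simps)
        also have "1 - k * l = k * p" using k by simp
        finally show ?thesis by (simp add: par [symmetric] algebra_simps)
      qed
      moreover have "fy z + (1 / (2 * H)) *\<^sub>R Ny z = k *\<^sub>R \<beta> *\<^sub>R X z"
      proof -
        have "fy z + (1 / (2 * H)) *\<^sub>R Ny z = (1 - k * p) *\<^sub>R fy z - (k * m) *\<^sub>R fx z"
          by (simp add: Ny_def P M V2 k_def algebra_simps)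
        also have "1 - k * p = k * l" using k by simp
        finally show ?thesis by (simp add: par [symmetric] algebra_simps)
      qed
      ultimately show ?thesis
        by (intro has_partials_cong [OF has_partials_diff [OF has_partials_add [OF partials(1)
              has_partials_linear [OF bounded_linear_scaleR_right partials_N]] c]]) simp_all
    qed
    from has_partials_zero_const [OF this, of _ 0] obtain C
      where C: "\<And>z. f z + (1 / (2 * H)) *\<^sub>R N z - c z *\<^sub>R U = C" by blast
    have "f z \<in> circular_cylinder C U (1 / (2 * \<bar>H\<bar>))" for z
    proof -
      have "f z = C + c z *\<^sub>R U + (- 1 / (2 * H)) *\<^sub>R N z"
        using C [of z] by (simp add: algebra_simps)
      moreover have "infdist (C + c z *\<^sub>R U + (- 1 / (2 * H)) *\<^sub>R N z) (range (\<lambda>t. C + t *\<^sub>R U)) = 1 / (2 * \<bar>H\<bar>)"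
        using XN [of z] X0 [of z]
        by (intro infdist_line U) (simp_all add: U_def norm_eq_sqrt_inner [of "N z"] N_simps)
      ultimately show ?thesis by (simp add: circular_cylinder_def)
    qed
    then show ?thesis
      unfolding part_of_circular_cylinder_def using U H_nonzero
      by (intro exI [of _ C] exI [of _ U] exI [of _ "1 / (2 * \<bar>H\<bar>)"]) auto
  qed
  have "l \<noteq> 0 \<or> p \<noteq> 0" using sum v H_nonzero by auto
  then show ?thesis
  proof
    assume "p \<noteq> 0"
    define X where "X z = p *\<^sub>R fx z - m *\<^sub>R fy z" for z
    show ?thesis
    proof (rule fin)
      show "has_partials X 0 0 z" for z
        unfolding X_def [abs_def]
        by (rule has_partials_cong [OF has_partials_diff [OF
                has_partials_linear [OF bounded_linear_scaleR_right partials(2)]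
                has_partials_linear [OF bounded_linear_scaleR_right partials(3)]]])
           (use lp in \<open>simp_all add: structure_equations L M P W0 mult.commute\<close>)
      have "X 0 \<bullet> fx 0 = p * v"
        by (simp add: X_def inner_diff_left inner_frame V2)
      then show "X 0 \<noteq> 0" using \<open>p \<noteq> 0\<close> v by auto
      show "X z \<bullet> N z = 0" for z by (simp add: X_def inner_diff_left inner_frame)
      show "p *\<^sub>R fx z - m *\<^sub>R fy z = 1 *\<^sub>R X z" for z by (simp add: X_def)
      have "l = m * m / p" using lp \<open>p \<noteq> 0\<close> by (metis nonzero_mult_div_cancel_right)
      then show "l *\<^sub>R fy z - m *\<^sub>R fx z = (- m / p) *\<^sub>R X z" for z
        using \<open>p \<noteq> 0\<close> by (simp add: X_def scaleR_diff_right)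
    qed
  next
    assume "l \<noteq> 0"
    define X where "X z = l *\<^sub>R fy z - m *\<^sub>R fx z" for z
    show ?thesis
    proof (rule fin)
      show "has_partials X 0 0 z" for z
        unfolding X_def [abs_def]
        by (rule has_partials_cong [OF has_partials_diff [OF
                has_partials_linear [OF bounded_linear_scaleR_right partials(3)]
                has_partials_linear [OF bounded_linear_scaleR_right partials(2)]]])
           (use lp in \<open>simp_all add: structure_equations L M P W0 mult.commute\<close>)
      have "X 0 \<bullet> fy 0 = l * v"
        by (simp add: X_def inner_diff_left inner_frame V2)
      then show "X 0 \<noteq> 0" using \<open>l \<noteq> 0\<close> v by auto
      show "X z \<bullet> N z = 0" for z by (simp add: X_def inner_diff_left inner_frame)
      show "l *\<^sub>R fy z - m *\<^sub>R fx z = 1 *\<^sub>R X z" for z by (simp add: X_def)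
      have "p = m * m / l" using lp \<open>l \<noteq> 0\<close> by (metis nonzero_mult_div_cancel_left)
      then show "p *\<^sub>R fx z - m *\<^sub>R fy z = (- m / l) *\<^sub>R X z" for z
        using \<open>l \<noteq> 0\<close> by (simp add: X_def scaleR_diff_right)
    qed
  qed
qed

subsection \<open>Congruence\<close>

lemma has_partials_axis_affine:
  assumes "has_partials k a b (Complex (\<epsilon> * Re z) (\<delta> * Im z) + c)"
  shows "has_partials (\<lambda>z. k (Complex (\<epsilon> * Re z) (\<delta> * Im z) + c)) (\<epsilon> *\<^sub>R a) (\<delta> *\<^sub>R b) z"
proof -
  have "((\<lambda>z. Complex (\<epsilon> * Re z) (\<delta> * Im z) + c) has_derivative (\<lambda>t. Complex (\<epsilon> * Re t) (\<delta> * Im t))) (at z)"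
    unfolding Complex_eq by (auto intro!: derivative_eq_intros)
  from has_derivative_compose [OF this assms [unfolded has_partials_def]]
  show ?thesis
    unfolding has_partials_def by (simp add: mult.commute)
qed

text \<open>The linear part of \<open>R\<close> carries the normal of \<open>f\<close> to
  \<open>\<sigma>\<close> times that of \<open>g\<close>. Since both have the same
  \<open>H \<noteq> 0\<close>, \<open>L + P = 2 H V^2\<close> forces
  \<open>\<sigma> = 1\<close>.\<close>

lemma second_fundamental_form_congruence:
  fixes R :: "real^3 \<Rightarrow> real^3"
  assumes f: "band_cmc f V H" and g: "band_cmc g V H"
    and R: "\<And>x y. dist (R x) (R y) = dist x y"
    and \<phi>: "\<And>z. \<phi> z = Complex (\<epsilon> * Re z) (\<delta> * Im z) + c" and \<epsilon>: "\<epsilon> * \<epsilon> = 1" and \<delta>: "\<delta> * \<delta> = 1"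
    and V: "\<And>z. V (Im (\<phi> z)) = V (Im z)"
    and g\<phi>: "\<And>z. g (\<phi> z) = R (f z)"
  shows "band_cmc.L f z = band_cmc.L g (\<phi> z)"
    and "band_cmc.M f z = \<epsilon> * \<delta> * band_cmc.M g (\<phi> z)"
proof -
  interpret f: band_cmc f V H by (rule f)
  interpret g: band_cmc g V H by (rule g)
  obtain A where A: "orthogonal_transformation A" and RA: "\<And>x. R x = R 0 + A x"
    using isometry_affine [OF R] by blast
  have linA: "bounded_linear A"
    using A orthogonal_transformation_linear linear_conv_bounded_linear by blast
  have innerA: "A x \<bullet> A y = x \<bullet> y" for x y
    using A by (simp add: orthogonal_transformation_def)
  have comp: "has_partials (\<lambda>z. k (\<phi> z)) (\<epsilon> *\<^sub>R a) (\<delta> *\<^sub>R b) z"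
    if "has_partials k a b (\<phi> z)" for a b z and k :: "complex \<Rightarrow> real^3"
    using that has_partials_axis_affine unfolding \<phi> by blast
  have "has_partials (\<lambda>z. g (\<phi> z)) (A (dx f z)) (A (dy f z)) z" for z
    unfolding g\<phi> RA [of "f _"]
    using has_partials_add [OF has_partials_const has_partials_linear [OF linA f.partials(1)]] by simp
  from has_partials_unique [OF this comp [OF g.partials(1)]]
  have A1: "A (dx f z) = \<epsilon> *\<^sub>R dx g (\<phi> z)" "A (dy f z) = \<delta> *\<^sub>R dy g (\<phi> z)" for z
    by blast+
  have "has_partials (\<lambda>z. \<epsilon> *\<^sub>R dx g (\<phi> z)) (A (dx (dx f) z)) (A (dy (dx f) z)) z"
    "has_partials (\<lambda>z. \<delta> *\<^sub>R dy g (\<phi> z)) (A (dy (dx f) z)) (A (dy (dy f) z)) z" for z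
    unfolding A1 [symmetric] by (intro has_partials_linear [OF linA] f.partials)+
  from has_partials_unique [OF this(1) has_partials_linear [OF bounded_linear_scaleR_right comp [OF g.partials(2)]]]
    has_partials_unique [OF this(2) has_partials_linear [OF bounded_linear_scaleR_right comp [OF g.partials(3)]]]
  have A2: "A (dx (dx f) z) = dx (dx g) (\<phi> z)" "A (dy (dx f) z) = (\<epsilon> * \<delta>) *\<^sub>R dy (dx g) (\<phi> z)"
    "A (dy (dy f) z) = dy (dy g) (\<phi> z)" for z
    using \<epsilon> \<delta> by simp_all
  define \<sigma> where "\<sigma> = A (unit_normal f z) \<bullet> unit_normal g (\<phi> z)"
  have "A (unit_normal f z) \<bullet> (\<epsilon> *\<^sub>R dx g (\<phi> z)) = 0" "A (unit_normal f z) \<bullet> (\<delta> *\<^sub>R dy g (\<phi> z)) = 0"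
    unfolding A1 [symmetric] innerA by (simp_all add: f.N_simps)
  then have "A (unit_normal f z) \<bullet> dx g (\<phi> z) = 0" "A (unit_normal f z) \<bullet> dy g (\<phi> z) = 0"
    using \<epsilon> \<delta> by auto
  then have AN: "A (unit_normal f z) = \<sigma> *\<^sub>R unit_normal g (\<phi> z)"
    using g.frame(7) [of "A (unit_normal f z)" "\<phi> z"] by (simp add: \<sigma>_def)
  have L: "f.L z = \<sigma> * g.L (\<phi> z)"
    using innerA [of "dx (dx f) z" "unit_normal f z"] by (simp add: AN A2 f.L_def g.L_def)
  moreover have "f.P z = \<sigma> * g.P (\<phi> z)"
    using innerA [of "dy (dy f) z" "unit_normal f z"] by (simp add: AN A2 f.P_def g.P_def)
  moreover have M: "f.M z = \<sigma> * (\<epsilon> * \<delta> * g.M (\<phi> z))"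
    using innerA [of "dy (dx f) z" "unit_normal f z"] by (simp add: AN A2 f.M_def g.M_def mult_ac)
  ultimately have "2 * H * (V (Im z))\<^sup>2 = \<sigma> * (2 * H * (V (Im z))\<^sup>2)"
    using f.mean_curvature_LP [of z] g.mean_curvature_LP [of "\<phi> z"] unfolding V
    by (simp add: distrib_left [symmetric])
  then have "\<sigma> = 1" using f.H_nonzero by simp
  then show "f.L z = g.L (\<phi> z)" "f.M z = \<epsilon> * \<delta> * g.M (\<phi> z)"
    using L M by simp_all
qed

subsection \<open>Rigidity of congruences\<close>

lemma entire_affine:
  fixes \<phi> p :: "complex \<Rightarrow> complex"
  assumes \<phi>: "\<And>z. (\<phi> has_field_derivative p z) (at z)" and "bounded (range p)"
  obtains \<alpha> \<beta> where "\<And>z. \<phi> z = \<alpha> * z + \<beta>" "\<And>z. p z = \<alpha>"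
proof -
  have "\<phi> holomorphic_on UNIV"
    using \<phi> by (auto simp: holomorphic_on_def field_differentiable_def)
  moreover have "deriv \<phi> = p"
    using \<phi> DERIV_imp_deriv by blast
  ultimately have "p holomorphic_on UNIV"
    using holomorphic_deriv [of \<phi> UNIV] by simp
  then obtain \<alpha> where \<alpha>: "\<And>z. p z = \<alpha>"
    using Liouville_theorem assms(2) unfolding constant_on_def by blast
  have "((\<lambda>z. \<phi> z - \<alpha> * z) has_field_derivative 0) (at z)" for z
    using \<phi> [of z] \<alpha> by (auto intro!: derivative_eq_intros)
  then have "\<exists>c. \<forall>z\<in>UNIV. \<phi> z - \<alpha> * z = c"
    by (intro has_field_derivative_zero_constant) (auto intro: has_field_derivative_at_within)
  then obtain \<beta> where "\<And>z. \<phi> z - \<alpha> * z = \<beta>" by auto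
  then show ?thesis using that \<alpha> by (metis diff_add_cancel add.commute)
qed

lemma orthogonal_complex:
  fixes p q :: complex
  assumes "p \<bullet> q = 0" "norm p = norm q" "p \<noteq> 0"
  shows "q / p = \<i> \<or> q / p = - \<i>"
proof -
  have "Re (q / p) = 0"
    using assms(1) by (simp add: inner_complex_def Re_divide mult.commute)
  moreover have "norm (q / p) = 1"
    using assms(2,3) by (metis divide_self norm_divide norm_eq_zero)
  ultimately show ?thesis
    by (auto simp: complex_eq_iff cmod_def real_sqrt_eq_iff abs_eq_iff)
qed

text \<open>The quotient \<open>q / p\<close> is continuous with values in
  \<open>{\<i>, - \<i>}\<close>, hence constant on the connected plane. So \<open>\<phi>\<close> or
  its conjugate is entire with bounded derivative, and Liouville's theorem applies.\<close>

lemma conformal_affine: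
  fixes \<phi> p q :: "complex \<Rightarrow> complex"
  assumes \<phi>: "\<And>z. has_partials \<phi> (p z) (q z) z"
    and cont: "continuous_on UNIV p" "continuous_on UNIV q"
    and conf: "\<And>z. p z \<bullet> q z = 0" "\<And>z. norm (p z) = norm (q z)" "\<And>z. p z \<noteq> 0"
    and bound: "bounded (range p)"
  obtains \<alpha> \<beta> where "(\<forall>z. \<phi> z = \<alpha> * z + \<beta>) \<or> (\<forall>z. \<phi> z = cnj (\<alpha> * z + \<beta>))" "\<And>z. norm (p z) = norm \<alpha>"
proof -
  have "\<forall>z\<in>UNIV. q z / p z \<in> {\<i>, - \<i>}"
    using orthogonal_complex [OF conf(1,2)] conf(3) by blast
  then have "finite ((\<lambda>z. q z / p z) ` UNIV)"
    by (meson finite.emptyI finite_insert finite_subset image_subsetI)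
  moreover have "continuous_on UNIV (\<lambda>z. q z / p z)"
    using cont conf(3) by (intro continuous_intros) auto
  ultimately have "(\<lambda>z. q z / p z) constant_on UNIV"
    using continuous_finite_range_constant [OF connected_UNIV] by blast
  then obtain s where s: "\<And>z. q z / p z = s"
    unfolding constant_on_def by blast
  then have q: "q z = s * p z" for z
    using conf(3) [of z] by (metis nonzero_eq_divide_eq)
  have "s = \<i> \<or> s = - \<i>"
    using orthogonal_complex [OF conf(1,2)] conf(3) s by metis
  then show ?thesis
  proof
    assume s: "s = \<i>"
    have "(\<phi> has_field_derivative p z) (at z)" for z
      using \<phi> [of z] unfolding has_partials_def has_field_derivative_def q
      by (rule has_derivative_eq_rhs) (simp add: s fun_eq_iff complex_eq_iff)
    from entire_affine [OF this bound] obtain \<alpha> \<beta> where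
      "\<And>z. \<phi> z = \<alpha> * z + \<beta>" "\<And>z. p z = \<alpha>" by blast
    then show ?thesis using that by metis
  next
    assume s: "s = - \<i>"
    have "((\<lambda>z. cnj (\<phi> z)) has_field_derivative cnj (p z)) (at z)" for z
      using has_partials_linear [OF bounded_linear_cnj \<phi> [of z]]
      unfolding has_partials_def has_field_derivative_def q
      by (rule has_derivative_eq_rhs) (simp add: s fun_eq_iff complex_eq_iff)
    moreover have "bounded (range (\<lambda>z. cnj (p z)))"
      using bound by (simp add: bounded_iff)
    ultimately obtain \<alpha> \<beta> where
      ab: "\<And>z. cnj (\<phi> z) = \<alpha> * z + \<beta>" "\<And>z. cnj (p z) = \<alpha>" by (rule entire_affine) blast
    then have "\<phi> z = cnj (\<alpha> * z + \<beta>)" "norm (p z) = norm \<alpha>" for z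
      by (metis complex_cnj_cnj, metis complex_mod_cnj)
    then show ?thesis using that by metis
  qed
qed

text \<open>Comparing the suprema of both sides of the scaling relation, with surjectivity for one
  direction, gives \<open>norm \<alpha> = 1\<close>. If \<open>\<alpha>\<close> were not real, the
  image of the real axis would meet every height, making \<open>V\<close> constant.\<close>

lemma band_isometry:
  fixes V :: "real \<Rightarrow> real"
  assumes V_pos: "\<And>y. V y > 0" and V_le: "\<And>y. V y \<le> K" and V_nonconst: "V y0 \<noteq> V 0"
    and \<phi>: "(\<forall>z. \<phi> z = \<alpha> * z + \<beta>) \<or> (\<forall>z. \<phi> z = cnj (\<alpha> * z + \<beta>))" and surj: "surj \<phi>"
    and V\<phi>: "\<And>z. V (Im (\<phi> z)) * norm \<alpha> = V (Im z)"
  obtains \<epsilon> \<delta> c where "\<And>z. \<phi> z = Complex (\<epsilon> * Re z) (\<delta> * Im z) + c" "\<epsilon> * \<epsilon> = 1" "\<delta> * \<delta> = 1"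
    "\<And>z. V (Im (\<phi> z)) = V (Im z)"
proof -
  define S where "S = (SUP y. V y)"
  have bdd: "bdd_above (range V)" using V_le by (intro bdd_aboveI2)
  have le_S: "V y \<le> S" for y
    unfolding S_def using bdd by (intro cSUP_upper) auto
  have "S > 0" using V_pos [of 0] le_S [of 0] by simp
  have "\<alpha> \<noteq> 0" using V\<phi> [of 0] V_pos [of "Im 0"] by auto
  have "S \<le> S * norm \<alpha>"
  proof -
    have "V y \<le> S * norm \<alpha>" for y
      using V\<phi> [of "Complex 0 y"] le_S by (metis complex.sel(2) mult_right_mono norm_ge_zero)
    then show ?thesis unfolding S_def by (intro cSUP_least) auto
  qed
  moreover have "S \<le> S / norm \<alpha>"
  proof -
    have "V y \<le> S / norm \<alpha>" for y
    proof -
      obtain z where "\<phi> z = Complex 0 y" using surj by (metis surjD)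
      then have "V y * norm \<alpha> = V (Im z)" using V\<phi> [of z] by simp
      then show ?thesis
        using le_S [of "Im z"] \<open>\<alpha> \<noteq> 0\<close> by (simp add: field_simps)
    qed
    then show ?thesis unfolding S_def by (intro cSUP_least) auto
  qed
  ultimately have norm_\<alpha>: "norm \<alpha> = 1"
    using \<open>S > 0\<close> \<open>\<alpha> \<noteq> 0\<close> by (simp add: field_simps)
  have V\<phi>': "V (Im (\<phi> z)) = V (Im z)" for z
    using V\<phi> norm_\<alpha> by simp
  have "Im \<alpha> = 0"
  proof (rule ccontr)
    assume Im: "Im \<alpha> \<noteq> 0"
    have "V y = V 0" for y
    proof -
      \<comment> \<open>The real point whose image has imaginary part \<open>y\<close>, solved
        separately for the two forms of \<open>\<phi>\<close>.\<close>
      define t where "t = (if \<forall>z. \<phi> z = \<alpha> * z + \<beta> then (y - Im \<beta>) / Im \<alpha> else (- y - Im \<beta>) / Im \<alpha>)"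
      have "Im (\<phi> (of_real t)) = y"
        using \<phi> Im unfolding t_def by auto
      then show ?thesis using V\<phi>' [of "of_real t"] by simp
    qed
    then show False using V_nonconst by blast
  qed
  moreover from this norm_\<alpha> have "\<bar>Re \<alpha>\<bar> = 1"
    by (simp add: cmod_def)
  then have "Re \<alpha> * Re \<alpha> = 1" by (metis abs_mult_self_eq mult_1)
  ultimately show ?thesis
    using \<phi> that [of "Re \<alpha>" "Re \<alpha>" \<beta>] that [of "Re \<alpha>" "- Re \<alpha>" "cnj \<beta>"] V\<phi>'
    by (auto simp: complex_eq_iff)
qed

text \<open>A congruence preserves \<open>L\<close>, which contains the real part of the Hopf
  differential; \<open>M\<close> may change sign under a coordinate reflection, so the real part is
  the invariant used to separate members.\<close>

lemma congruent_hopf_Re: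
  assumes f: "band_hopf f V H P" and g: "band_hopf g V H Q"
    and V_le: "\<And>y. V y \<le> K" "\<And>y. 1 / V y \<le> K" and V_nonconst: "V y0 \<noteq> V 0"
    and congruent: "congruent_immersions f g"
  shows "Re P = Re Q"
proof -
  interpret f: band_hopf f V H P by (rule f)
  interpret g: band_hopf g V H Q by (rule g)
  from congruent obtain \<phi> R where "plane_diffeomorphism \<phi>" and R: "\<And>x y. dist (R x) (R y) = dist x y"
    and "g \<circ> \<phi> = R \<circ> f"
    unfolding congruent_immersions_def by blast
  then have smooth: "smooth \<phi>" and surj: "surj \<phi>" and g\<phi>: "\<And>z. g (\<phi> z) = R (f z)"
    unfolding plane_diffeomorphism_def by (auto simp: bij_def fun_eq_iff)
  obtain A where A: "orthogonal_transformation A" and RA: "\<And>x. R x = R 0 + A x"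
    using isometry_affine [OF R] by blast
  have linA: "bounded_linear A"
    using A orthogonal_transformation_linear linear_conv_bounded_linear by blast
  have innerA: "A x \<bullet> A y = x \<bullet> y" for x y
    using A by (simp add: orthogonal_transformation_def)
  let ?p = "dx \<phi>" and ?q = "dy \<phi>"
  \<comment> \<open>The differential of \<open>g\<close> at \<open>\<phi> z\<close>. It multiplies
    inner products by the squared conformal factor, so comparison with \<open>f\<close> makes
    \<open>\<phi>\<close> conformal, with stretching factor a quotient of two values of
    \<open>V\<close>.\<close>
  define X where "X z t = Re t *\<^sub>R dx g (\<phi> z) + Im t *\<^sub>R dy g (\<phi> z)" for z t
  have inner_X: "X z s \<bullet> X z t = (V (Im (\<phi> z)))\<^sup>2 * (s \<bullet> t)" for z s t
    by (simp add: X_def inner_add_left inner_add_right g.inner_frame inner_complex_def algebra_simps)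
  have "has_partials (\<lambda>z. g (\<phi> z)) (X z (?p z)) (X z (?q z)) z" for z
  proof -
    have "(g has_derivative (\<lambda>t. Re t *\<^sub>R dx g (\<phi> z) + Im t *\<^sub>R dy g (\<phi> z))) (at (\<phi> z))"
      using g.partials(1) by (simp add: has_partials_def)
    from has_derivative_compose [OF smooth_has_partials [OF smooth, unfolded has_partials_def] this]
    show ?thesis
      unfolding has_partials_def X_def
      by (rule has_derivative_eq_rhs) (simp add: fun_eq_iff algebra_simps)
  qed
  moreover have "has_partials (\<lambda>z. g (\<phi> z)) (A (dx f z)) (A (dy f z)) z" for z
    unfolding g\<phi> RA [of "f _"]
    using has_partials_add [OF has_partials_const has_partials_linear [OF linA f.partials(1)]] by simp
  ultimately have X: "X z (?p z) = A (dx f z)" "X z (?q z) = A (dy f z)" for z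
    using has_partials_unique by blast+
  have pq: "(V (Im (\<phi> z)))\<^sup>2 * (?p z \<bullet> ?p z) = (V (Im z))\<^sup>2"
    "(V (Im (\<phi> z)))\<^sup>2 * (?q z \<bullet> ?q z) = (V (Im z))\<^sup>2"
    "?p z \<bullet> ?q z = 0" for z
    using inner_X [of z "?p z" "?p z"] inner_X [of z "?q z" "?q z"] inner_X [of z "?p z" "?q z"]
    unfolding X innerA by (simp_all add: f.inner_frame)
  have norm_p: "V (Im (\<phi> z)) * norm (?p z) = V (Im z)" for z
    using pq(1) [of z] f.V_pos
    by (metis norm_ge_zero less_imp_le mult_nonneg_nonneg power2_eq_iff_nonneg power2_norm_eq_inner power_mult_distrib)
  have norm_q: "V (Im (\<phi> z)) * norm (?q z) = V (Im z)" for z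
    using pq(2) [of z] f.V_pos
    by (metis norm_ge_zero less_imp_le mult_nonneg_nonneg power2_eq_iff_nonneg power2_norm_eq_inner power_mult_distrib)
  obtain \<alpha> \<beta> where ab: "(\<forall>z. \<phi> z = \<alpha> * z + \<beta>) \<or> (\<forall>z. \<phi> z = cnj (\<alpha> * z + \<beta>))"
    and norm_\<alpha>: "\<And>z. norm (?p z) = norm \<alpha>"
  proof (rule conformal_affine)
    show "has_partials \<phi> (?p z) (?q z) z" for z
      by (rule smooth_has_partials [OF smooth])
    show "continuous_on UNIV ?p" "continuous_on UNIV ?q"
      using smooth by (blast intro: smooth_continuous smooth_dx smooth_dy)+
    show "?p z \<bullet> ?q z = 0" for z by (rule pq)
    show "norm (?p z) = norm (?q z)" for z
      using norm_p [of z] norm_q [of z] f.V_pos [of "Im (\<phi> z)"] by (metis less_irrefl mult_left_cancel)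
    show "?p z \<noteq> 0" for z
      using norm_p [of z] f.V_pos [of "Im z"] by auto
    have "K \<ge> 0" using V_le(1) [of 0] f.V_pos [of 0] by linarith
    have "norm (?p z) \<le> K * K" for z
    proof -
      have "norm (?p z) = V (Im z) * (1 / V (Im (\<phi> z)))"
        using norm_p [of z] f.V_pos [of "Im (\<phi> z)"] by (simp add: field_simps)
      also have "\<dots> \<le> K * K"
        using V_le f.V_pos less_imp_le [OF f.V_pos] \<open>K \<ge> 0\<close> by (intro mult_mono) auto
      finally show ?thesis .
    qed
    then show "bounded (range ?p)" by (auto simp: bounded_iff)
  qed blast
  obtain \<epsilon> \<delta> c where \<phi>: "\<And>z. \<phi> z = Complex (\<epsilon> * Re z) (\<delta> * Im z) + c"
    and "\<epsilon> * \<epsilon> = 1" "\<delta> * \<delta> = 1" and V\<phi>: "\<And>z. V (Im (\<phi> z)) = V (Im z)"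
    using band_isometry [OF f.V_pos V_le(1) V_nonconst ab surj] norm_p unfolding norm_\<alpha> by metis
  from second_fundamental_form_congruence(1) [OF f.band_cmc_axioms g.band_cmc_axioms R this g\<phi>, of 0]
  show ?thesis by (simp add: f.L_eq g.L_eq V\<phi>)
qed

subsection \<open>Closing the associated family\<close>

lemma ex_antiderivative:
  fixes g :: "real \<Rightarrow> real"
  assumes "continuous_on UNIV g"
  obtains G where "\<And>y. (G has_real_derivative g y) (at y)"
proof -
  have "isCont g y" for y
    using assms by (simp add: continuous_on_eq_continuous_at)
  then have "\<exists>G. \<forall>y. - \<infinity> < ereal y \<longrightarrow> ereal y < \<infinity> \<longrightarrow> (G has_vector_derivative g y) (at y)"
    by (intro einterval_antiderivative) auto
  then show ?thesis
    using that by (auto simp: has_real_derivative_iff_has_vector_derivative)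
qed

lemma integral_antiderivative:
  fixes g :: "real \<Rightarrow> real"
  assumes "\<And>y. (G has_real_derivative g y) (at y)" "0 \<le> T"
  shows "G T - G 0 = integral {0..T} g"
proof (rule integral_unique [symmetric], rule fundamental_theorem_of_calculus [OF assms(2)])
  show "(G has_vector_derivative g y) (at y within {0..T})" for y
    using assms(1) by (simp add: has_real_derivative_iff_has_vector_derivative has_vector_derivative_at_within)
qed

lemma (in band_cmc) continuous_V: "continuous_on S V"
  using deriv_V by (intro continuous_at_imp_continuous_on) (auto intro: DERIV_isCont)

context band_screw
begin

lemma closing_integral:
  fixes n :: int
  assumes "0 \<le> T" and T: "\<And>y. V (y + T) = V y"
    and height: "a * h * s = integral {0..T} (\<lambda>y. H * (V y)\<^sup>2 + 2 * Re Q)"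
    and angle: "a * s + integral {0..T} \<beta> = 2 * pi * of_int n"
  shows "f (z + Complex s T) = f z"
proof -
  have "continuous_on UNIV (\<lambda>y. H * (V y)\<^sup>2 + 2 * Re Q)"
    by (intro continuous_intros continuous_V)
  then obtain G1 where G1: "\<And>y. (G1 has_real_derivative H * (V y)\<^sup>2 + 2 * Re Q) (at y)"
    using ex_antiderivative by blast
  have "(V y)\<^sup>2 - h\<^sup>2 \<noteq> 0" for y
    using V2_h2_pos [of y] by simp
  then have "continuous_on UNIV \<beta>"
    unfolding \<beta>_def [abs_def] by (intro continuous_intros continuous_V) auto
  then obtain G2 where G2: "\<And>y. (G2 has_real_derivative \<beta> y) (at y)"
    using ex_antiderivative by blast
  show ?thesis
    by (rule closing_condition [OF G1 G2 T, where n = n])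
       (use height angle integral_antiderivative [OF G1 assms(1)] integral_antiderivative [OF G2 assms(1)] in auto)
qed

text \<open>Up to the summand \<open>4 H Re Q\<close> this is the conserved energy of the
  sinh-Gordon equation, so along the family \<open>a\<close> varies only with
  \<open>Re Q\<close>.\<close>

lemma a2_energy: "a\<^sup>2 = (W y)\<^sup>2 + 4 * (cmod Q)\<^sup>2 / (V y)\<^sup>2 + H\<^sup>2 * (V y)\<^sup>2 + 4 * H * Re Q"
proof -
  have "(V y)\<^sup>2 * a\<^sup>2 = 4 * (Im Q)\<^sup>2 + (H * (V y)\<^sup>2 + 2 * Re Q)\<^sup>2 + (V y)\<^sup>2 * (W y)\<^sup>2"
    using omega_norm [of "Complex 0 y"] by (simp add: a2_eq M_eq L_eq)
  then have "a\<^sup>2 = (4 * (Im Q)\<^sup>2 + (H * (V y)\<^sup>2 + 2 * Re Q)\<^sup>2 + (V y)\<^sup>2 * (W y)\<^sup>2) / (V y)\<^sup>2"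
    by (simp add: field_simps)
  then show ?thesis
    unfolding cmod_power2 by (simp add: field_simps power2_eq_square)
qed

end

text \<open>Rotational symmetry makes the metric and then the second fundamental form independent of
  \<open>x\<close>; \<open>codazzi_constant\<close> makes the Hopf differential constant. The
  members of the family inherit all of this from their common metric, their common \<open>H\<close>
  and the rotated Hopf differential.\<close>

lemma delaunay_associated_family:
  assumes "delaunay_surface f" and "associated_family f F"
  obtains V H Q where "band_hopf f V H Q"
    and "\<And>\<mu>. norm \<mu> = 1 \<Longrightarrow> band_hopf (F \<mu>) V H (inverse (\<mu>\<^sup>2) * Q)"
proof -
  from assms(2) obtain v H where H: "H \<noteq> 0" and cmc: "conformal_cmc f H" and v: "has_conformal_metric f v"
    and F: "\<And>\<mu>. norm \<mu> = 1 \<Longrightarrow> conformal_cmc (F \<mu>) H \<and> has_conformal_metric (F \<mu>) v \<and>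
           (\<forall>z. hopf (F \<mu>) z = inverse (\<mu>\<^sup>2) * hopf f z)"
    unfolding associated_family_def by blast
  have smooth: "smooth f"
    using cmc by (simp add: conformal_cmc_def conformal_immersion_def)
  from assms(1) obtain R where "nontrivial_rotation_group R" and fR: "\<And>s z. f (z + of_real s) = R s (f z)"
    unfolding delaunay_surface_def by blast
  then have R: "dist (R s x) (R s y) = dist x y" for s x y
    unfolding nontrivial_rotation_group_def by (metis rotation_about_isometry)
  have v_shift: "v (z + of_real s) = v z" for z s
  proof -
    obtain A where A: "orthogonal_transformation A" and RA: "\<And>x. R s x = R s 0 + A x"
      using isometry_affine [OF R] by blast
    have linA: "bounded_linear A"
      using A orthogonal_transformation_linear linear_conv_bounded_linear by blast
    have "has_partials (\<lambda>z. f (z + of_real s)) (A (dx f z)) (A (dy f z)) z"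
      unfolding fR RA [of "f _"]
      using has_partials_add [OF has_partials_const has_partials_linear [OF linA smooth_has_partials [OF smooth]]]
      by simp
    moreover have "has_partials (\<lambda>z. f (z + of_real s)) (dx f (z + of_real s)) (dy f (z + of_real s)) z"
      using has_partials_axis_affine [of f _ _ 1 z 1 "of_real s"] smooth_has_partials [OF smooth] by simp
    ultimately have "A (dx f z) = dx f (z + of_real s)"
      using has_partials_unique by blast
    then have "dx f (z + of_real s) \<bullet> dx f (z + of_real s) = dx f z \<bullet> dx f z"
      using A by (metis orthogonal_transformation_def)
    then have "(v (z + of_real s))\<^sup>2 = (v z)\<^sup>2"
      using v by (simp add: has_conformal_metric_def)
    then show ?thesis
      using v by (metis has_conformal_metric_def less_imp_le power2_eq_iff_nonneg)
  qed
  define V where "V y = v (Complex 0 y)" for y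
  have "v z = V (Im z)" for z
  proof -
    have "Complex 0 (Im z) + of_real (Re z) = z" by (simp add: complex_eq_iff)
    then show ?thesis using v_shift [of "Complex 0 (Im z)" "Re z"] by (simp add: V_def)
  qed
  then have vV: "v = (\<lambda>z. V (Im z))" by blast
  have band: "band_cmc g V H" if "conformal_cmc g H" "has_conformal_metric g v" for g
    using that H by unfold_locales (auto simp: vV conformal_cmc_def conformal_immersion_def)
  interpret band_cmc f V H by (rule band [OF cmc v])
  \<comment> \<open>Translation by \<open>s\<close> is a congruence of \<open>f\<close> with itself,
    realised by the rotation \<open>R s\<close>.\<close>
  have "L z = L (z + of_real s)" "M z = M (z + of_real s)" for z s
    using second_fundamental_form_congruence [OF band_cmc_axioms band_cmc_axioms R [of s],
        of "\<lambda>z. z + of_real s" 1 1 "of_real s" z] fR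
    by simp_all
  then have hopf: "hopf f z = hopf f 0" for z
    by (intro codazzi_constant) auto
  show ?thesis
  proof
    show "band_hopf f V H (hopf f 0)"
      by unfold_locales (rule hopf)
    show "band_hopf (F \<mu>) V H (inverse (\<mu>\<^sup>2) * hopf f 0)" if "norm \<mu> = 1" for \<mu>
      using band F [OF that] hopf unfolding band_hopf_def band_hopf_axioms_def by auto
  qed
qed

section \<open>The family parametrised by the phase of the Hopf differential\<close>

lemma ex_rotated_hopf:
  assumes "Q \<noteq> 0" "norm w = norm Q"
  obtains \<mu> :: complex where "norm \<mu> = 1" "inverse (\<mu>\<^sup>2) * Q = w"
proof
  have w: "w \<noteq> 0" using assms by auto
  have "(norm (csqrt (Q / w)))\<^sup>2 = 1"
    using assms w by (simp add: norm_power [symmetric] norm_divide)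
  then show "norm (csqrt (Q / w)) = 1"
    by (simp add: power2_eq_1_iff)
  show "inverse ((csqrt (Q / w))\<^sup>2) * Q = w"
    using assms w by simp
qed

locale delaunay_family =
  fixes f :: "complex \<Rightarrow> real^3" and F :: "complex \<Rightarrow> complex \<Rightarrow> real^3"
    and V :: "real \<Rightarrow> real" and H :: real and Q :: complex
  assumes f_band: "band_hopf f V H Q" and Q_nonzero: "Q \<noteq> 0"
    and F_band: "\<And>\<mu>. norm \<mu> = 1 \<Longrightarrow> band_hopf (F \<mu>) V H (inverse (\<mu>\<^sup>2) * Q)"
begin

definition "\<kappa> = norm Q"

lemma \<kappa>_pos: "\<kappa> > 0"
  using Q_nonzero by (simp add: \<kappa>_def)

sublocale f: band_hopf f V H Q
  by (rule f_band)

sublocale sg: sinh_gordon V f.W "4 * \<kappa>\<^sup>2" "H\<^sup>2"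
  using f.sinh_gordon Q_nonzero by (simp add: \<kappa>_def)

text \<open>The member of the family whose Hopf differential is \<open>sgn H * \<kappa> * cis (- \<theta>)\<close>: for \<open>\<theta>\<close> near
  \<open>0\<close> its screw motions are close to rotations, and \<open>L\<close> has no zeros.\<close>

definition "rotated_hopf \<theta> = of_real (sgn H * \<kappa>) * cis (- \<theta>)"

definition "\<mu> \<theta> = (SOME \<mu>. norm \<mu> = 1 \<and> inverse (\<mu>\<^sup>2) * Q = rotated_hopf \<theta>)"

lemma rotated_hopf: "Re (rotated_hopf \<theta>) = sgn H * (\<kappa> * cos \<theta>)" "Im (rotated_hopf \<theta>) = - (sgn H * (\<kappa> * sin \<theta>))"
  and norm_rotated_hopf: "norm (rotated_hopf \<theta>) = \<kappa>"
  using \<kappa>_pos f.H_nonzero by (simp_all add: rotated_hopf_def norm_mult abs_sgn_eq)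

lemma \<mu>: "norm (\<mu> \<theta>) = 1" "inverse ((\<mu> \<theta>)\<^sup>2) * Q = rotated_hopf \<theta>"
proof -
  have "norm (rotated_hopf \<theta>) = norm Q"
    by (simp add: norm_rotated_hopf \<kappa>_def)
  then have "\<exists>\<mu>. norm \<mu> = 1 \<and> inverse (\<mu>\<^sup>2) * Q = rotated_hopf \<theta>"
    using ex_rotated_hopf [OF Q_nonzero] by blast
  from someI_ex [OF this] show "norm (\<mu> \<theta>) = 1" "inverse ((\<mu> \<theta>)\<^sup>2) * Q = rotated_hopf \<theta>"
    by (simp_all add: \<mu>_def)
qed

lemma H_sgn: "H * sgn H = \<bar>H\<bar>" "sgn H * H = \<bar>H\<bar>" "sgn H * sgn H = 1" "H = sgn H * \<bar>H\<bar>"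
  using f.H_nonzero by (auto simp: sgn_real_def)

text \<open>\<open>l\<close>, \<open>A\<close>, \<open>pitch\<close> and \<open>b\<close> are
  \<open>L\<close>, \<open>a\<close>, \<open>h\<close> and \<open>\<beta>\<close> of the member
  \<open>F (\<mu> \<theta>)\<close>, with \<open>sgn H\<close> split off from \<open>L\<close> and
  \<open>h\<close>. As explicit formulas in \<open>\<theta>\<close> they show continuity even though
  \<open>\<mu>\<close> is an arbitrary choice.\<close>

definition "l \<theta> y = \<bar>H\<bar> * (V y)\<^sup>2 + 2 * \<kappa> * cos \<theta>"
definition "A \<theta> = sqrt (sg.energy + 4 * \<bar>H\<bar> * \<kappa> * cos \<theta>)"
definition "pitch \<theta> = 2 * \<kappa> * sin \<theta> / A \<theta>"
definition "b \<theta> y = pitch \<theta> * l \<theta> y / ((V y)\<^sup>2 - (pitch \<theta>)\<^sup>2)"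

text \<open>The angle swept about the axis over one candidate period: the first summand is
  \<open>a s\<close> for the shift \<open>s\<close> that closes the height.\<close>

definition "\<Theta> T \<theta> = A \<theta> / (2 * \<kappa> * sin \<theta>) * integral {0..T} (l \<theta>) + integral {0..T} (b \<theta>)"

lemma band_screw:
  assumes "0 < \<theta>" "\<theta> < pi / 2"
  shows "band_screw (F (\<mu> \<theta>)) V H (rotated_hopf \<theta>)"
proof -
  interpret g: band_hopf "F (\<mu> \<theta>)" V H "rotated_hopf \<theta>"
    using F_band [OF \<mu>(1)] by (simp add: \<mu>(2))
  show ?thesis
  proof
    fix z
    have "sgn H * g.L z = \<bar>H\<bar> * (V (Im z))\<^sup>2 + 2 * (\<kappa> * cos \<theta>)"
      unfolding g.L_eq rotated_hopf
      by (simp add: distrib_left mult.assoc [symmetric] H_sgn(1-3)) (simp add: f.H_nonzero)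
    also have "\<dots> > 0"
      using assms \<kappa>_pos by (intro add_nonneg_pos mult_pos_pos) (auto simp: cos_gt_zero)
    finally show "g.L z \<noteq> 0" by auto
  qed
qed

lemma screw_data:
  assumes "0 < \<theta>" "\<theta> < pi / 2"
  shows "band_screw.a (F (\<mu> \<theta>)) V = A \<theta>"
    and "band_screw.h (F (\<mu> \<theta>)) V (rotated_hopf \<theta>) = sgn H * pitch \<theta>"
    and "A \<theta> > 0" "pitch \<theta> > 0" "(V y)\<^sup>2 - (pitch \<theta>)\<^sup>2 > 0"
    and "band_screw.\<beta> (F (\<mu> \<theta>)) V H (rotated_hopf \<theta>) = b \<theta>"
proof -
  interpret g: band_screw "F (\<mu> \<theta>)" V H "rotated_hopf \<theta>"
    by (rule band_screw [OF assms])
  have "g.a\<^sup>2 = sg.energy + 4 * \<bar>H\<bar> * \<kappa> * cos \<theta>"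
    using g.a2_energy [of 0] sg.energy [of 0]
    by (simp add: norm_rotated_hopf rotated_hopf H_sgn(1) mult.assoc [symmetric])
  then show a: "g.a = A \<theta>"
    unfolding A_def using g.a_pos by (metis less_imp_le real_sqrt_unique)
  show A: "A \<theta> > 0" using g.a_pos a by simp
  show h: "g.h = sgn H * pitch \<theta>"
    unfolding g.h_def a by (simp add: rotated_hopf pitch_def)
  show "pitch \<theta> > 0"
    using A \<kappa>_pos assms by (simp add: pitch_def sin_gt_zero)
  have h2: "g.h\<^sup>2 = (pitch \<theta>)\<^sup>2"
    unfolding h using H_sgn(3) by (simp add: power_mult_distrib power2_eq_square)
  show "(V y)\<^sup>2 - (pitch \<theta>)\<^sup>2 > 0"
    using g.V2_h2_pos [of y] by (simp add: h2)
  show "g.\<beta> = b \<theta>"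
  proof
    fix y
    have "g.h * (H * (V y)\<^sup>2 + 2 * Re (rotated_hopf \<theta>))
        = pitch \<theta> * ((sgn H * H) * (V y)\<^sup>2 + 2 * ((sgn H * sgn H) * (\<kappa> * cos \<theta>)))"
      unfolding h rotated_hopf by (simp only: algebra_simps)
    also have "\<dots> = pitch \<theta> * l \<theta> y"
      unfolding H_sgn(1-3) by (simp add: l_def)
    finally show "g.\<beta> y = b \<theta> y"
      by (simp add: g.\<beta>_def b_def h2)
  qed
qed

lemma cylinder_condition:
  fixes n :: int
  assumes \<theta>: "0 < \<theta>" "\<theta> < pi / 2" and T: "T > 0" "\<And>y. V (y + T) = V y"
    and closed: "\<Theta> T \<theta> = 2 * pi * of_int n"
  shows "screw_motion_symmetric (F (\<mu> \<theta>))" "is_cylinder (F (\<mu> \<theta>))"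
proof -
  interpret g: band_screw "F (\<mu> \<theta>)" V H "rotated_hopf \<theta>"
    by (rule band_screw [OF \<theta>])
  show "screw_motion_symmetric (F (\<mu> \<theta>))"
    by (rule g.screw_motion_symmetric)
  define s where "s = integral {0..T} (l \<theta>) / (2 * \<kappa> * sin \<theta>)"
  have sin: "sin \<theta> > 0" using \<theta> by (simp add: sin_gt_zero)
  have "F (\<mu> \<theta>) (z + Complex s T) = F (\<mu> \<theta>) z" for z
  proof (rule g.closing_integral [where n = n])
    show "0 \<le> T" using T by simp
    show "V (y + T) = V y" for y by (rule T)
    have "(\<lambda>y. H * (V y)\<^sup>2 + 2 * Re (rotated_hopf \<theta>)) = (\<lambda>y. sgn H * l \<theta> y)"
      unfolding rotated_hopf l_def by (subst (1) H_sgn(4)) (simp add: algebra_simps)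
    then have "integral {0..T} (\<lambda>y. H * (V y)\<^sup>2 + 2 * Re (rotated_hopf \<theta>)) = sgn H * integral {0..T} (l \<theta>)"
      by simp
    moreover have "g.a * g.h * s = sgn H * integral {0..T} (l \<theta>)"
      unfolding screw_data [OF \<theta>] using screw_data(3) [OF \<theta>] sin \<kappa>_pos
      by (simp add: pitch_def s_def)
    ultimately show "g.a * g.h * s = integral {0..T} (\<lambda>y. H * (V y)\<^sup>2 + 2 * Re (rotated_hopf \<theta>))"
      by simp
    show "g.a * s + integral {0..T} g.\<beta> = 2 * pi * of_int n"
      unfolding screw_data [OF \<theta>] using closed by (simp add: \<Theta>_def s_def)
  qed
  moreover have "Complex s T \<noteq> 0" using T by (simp add: complex_eq_iff)
  ultimately show "is_cylinder (F (\<mu> \<theta>))"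
    unfolding is_cylinder_def by blast
qed

section \<open>The total angle as a function of the phase\<close>

lemma continuous_\<Theta>:
  assumes "0 < \<epsilon>" "\<epsilon>' < pi / 2"
  shows "continuous_on {\<epsilon>..\<epsilon>'} (\<Theta> T)"
proof -
  have \<theta>: "0 < \<theta>" "\<theta> < pi / 2" if "\<theta> \<in> {\<epsilon>..\<epsilon>'}" for \<theta>
    using that assms by auto
  have sin: "sin \<theta> \<noteq> 0" if "\<theta> \<in> {\<epsilon>..\<epsilon>'}" for \<theta>
    using sin_gt_zero [of \<theta>] \<theta> [OF that] by auto
  have A: "continuous_on {\<epsilon>..\<epsilon>'} A"
    unfolding A_def [abs_def] by (intro continuous_intros)
  have pitch: "continuous_on {\<epsilon>..\<epsilon>'} pitch"
    unfolding pitch_def [abs_def] using screw_data(3) [OF \<theta>]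
    by (intro continuous_intros A) (auto simp: less_le)
  have V: "continuous_on S (\<lambda>x. V (snd x))" for S :: "(real \<times> real) set"
    by (rule continuous_on_compose2 [OF f.continuous_V continuous_on_snd [OF continuous_on_id] subset_UNIV])
  have l': "continuous_on ({\<epsilon>..\<epsilon>'} \<times> cbox 0 T) (\<lambda>x. l (fst x) (snd x))"
    unfolding l_def by (intro continuous_intros V)
  have pitch': "continuous_on ({\<epsilon>..\<epsilon>'} \<times> cbox 0 T) (\<lambda>x. pitch (fst x))"
    by (rule continuous_on_compose2 [OF pitch]) (auto intro: continuous_intros)
  have b': "continuous_on ({\<epsilon>..\<epsilon>'} \<times> cbox 0 T) (\<lambda>x. b (fst x) (snd x))"
    unfolding b_def
  proof (intro continuous_intros pitch' l' V ballI)
    fix x assume "x \<in> {\<epsilon>..\<epsilon>'} \<times> cbox 0 T"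
    then have "fst x \<in> {\<epsilon>..\<epsilon>'}" by auto
    from screw_data(5) [OF \<theta> [OF this]] show "(V (snd x))\<^sup>2 - (pitch (fst x))\<^sup>2 \<noteq> 0"
      by (simp add: less_le)
  qed
  have "continuous_on {\<epsilon>..\<epsilon>'} (\<lambda>\<theta>. integral (cbox 0 T) (l \<theta>))"
    "continuous_on {\<epsilon>..\<epsilon>'} (\<lambda>\<theta>. integral (cbox 0 T) (b \<theta>))"
    by (rule integral_continuous_on_param, unfold case_prod_unfold, rule l' b')+
  then show ?thesis
    unfolding \<Theta>_def [abs_def] using \<kappa>_pos sin
    by (intro continuous_intros A) auto
qed

text \<open>\<open>A\<close> and the integral of \<open>l\<close> stay above positive constants, so
  the first summand of \<open>\<Theta>\<close> grows at least like \<open>1 / sin \<theta>\<close>;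
  the second is nonnegative.\<close>

lemma \<Theta>_unbounded:
  assumes T: "T > 0"
  obtains C where "C > 0" "\<And>\<theta>. \<lbrakk>0 < \<theta>; \<theta> < pi / 2\<rbrakk> \<Longrightarrow> C / \<theta> \<le> \<Theta> T \<theta>"
proof -
  obtain K where K: "K > 0" "\<And>y. 1 / V y \<le> K"
    using sg.bounds by blast
  define m where "m = \<bar>H\<bar> * (1 / K)\<^sup>2"
  have m: "m > 0" using K f.H_nonzero by (simp add: m_def)
  define C where "C = sqrt sg.energy / (2 * \<kappa>) * (m * T)"
  show ?thesis
  proof
    show "C > 0" unfolding C_def using sg.energy_pos \<kappa>_pos m T by simp
    fix \<theta> :: real assume \<theta>: "0 < \<theta>" "\<theta> < pi / 2"
    have sin: "0 < sin \<theta>" "sin \<theta> \<le> \<theta>" and cos: "0 < cos \<theta>"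
      using \<theta> by (auto simp: sin_gt_zero sin_x_le_x cos_gt_zero)
    have cont_l: "continuous_on {0..T} (l \<theta>)"
      unfolding l_def [abs_def] by (intro continuous_intros f.continuous_V)
    have cont_b: "continuous_on {0..T} (b \<theta>)"
      unfolding b_def [abs_def] using screw_data(5) [OF \<theta>] cont_l
      by (intro continuous_intros f.continuous_V) (auto simp: less_le)
    have l: "m \<le> l \<theta> y" for y
    proof -
      have "1 / K \<le> V y" using K(2) [of y] K(1) sg.V_pos [of y] by (simp add: field_simps)
      then have "m \<le> \<bar>H\<bar> * (V y)\<^sup>2"
        unfolding m_def using K(1) by (intro mult_left_mono power_mono) auto
      then show ?thesis using cos \<kappa>_pos by (simp add: l_def add_increasing2)
    qed
    have "m * T = integral {0..T} (\<lambda>y. m)" using T by simp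
    also have "\<dots> \<le> integral {0..T} (l \<theta>)"
      using l cont_l by (intro integral_le integrable_continuous_interval) auto
    finally have int_l: "m * T \<le> integral {0..T} (l \<theta>)" .
    have "0 \<le> b \<theta> y" for y
      unfolding b_def using screw_data(4,5) [OF \<theta>] l [of y] m by (intro divide_nonneg_pos mult_nonneg_nonneg) auto
    then have int_b: "0 \<le> integral {0..T} (b \<theta>)"
      using cont_b by (intro integral_nonneg integrable_continuous_interval) auto
    have "sqrt sg.energy \<le> A \<theta>"
      unfolding A_def using cos \<kappa>_pos by simp
    then have "sqrt sg.energy / (2 * \<kappa> * \<theta>) \<le> A \<theta> / (2 * \<kappa> * sin \<theta>)"
      using sin \<kappa>_pos \<theta> screw_data(3) [OF \<theta>] by (intro frac_le) auto
    then have "sqrt sg.energy / (2 * \<kappa> * \<theta>) * (m * T) \<le> A \<theta> / (2 * \<kappa> * sin \<theta>) * integral {0..T} (l \<theta>)"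
      using int_l m T screw_data(3) [OF \<theta>] sin \<kappa>_pos by (intro mult_mono) auto
    then show "C / \<theta> \<le> \<Theta> T \<theta>"
      using int_b by (simp add: \<Theta>_def C_def)
  qed
qed

lemma ex_\<Theta>:
  assumes T: "T > 0"
  obtains t :: "nat \<Rightarrow> real" and n0 where "\<And>n. n0 \<le> n \<Longrightarrow> 0 < t n \<and> t n < pi / 2 \<and> \<Theta> T (t n) = 2 * pi * n"
proof -
  obtain C where C: "C > 0" "\<And>\<theta>. \<lbrakk>0 < \<theta>; \<theta> < pi / 2\<rbrakk> \<Longrightarrow> C / \<theta> \<le> \<Theta> T \<theta>"
    using \<Theta>_unbounded [OF T] by blast
  obtain n0 :: nat where n0: "\<Theta> T (pi / 4) / (2 * pi) < n0"
    using reals_Archimedean2 by blast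
  \<comment> \<open>Beginning with \<open>Suc n0\<close> makes \<open>n\<close> positive, as the
    division by \<open>n\<close> below requires. By the choice of \<open>n0\<close>, the value at
    \<open>pi / 4\<close> lies below \<open>2 * pi * n\<close>.\<close>
  have "\<exists>\<theta>. 0 < \<theta> \<and> \<theta> < pi / 2 \<and> \<Theta> T \<theta> = 2 * pi * n" if "Suc n0 \<le> n" for n :: nat
  proof -
    \<comment> \<open>Chosen so that the lower bound \<open>C / \<epsilon>\<close> reaches
      \<open>2 * pi * n\<close>; the intermediate value theorem then applies between
      \<open>\<epsilon>\<close> and \<open>pi / 4\<close>.\<close>
    define \<epsilon> where "\<epsilon> = min (pi / 4) (C / (2 * pi * n))"
    have n: "real n > 0" "real n0 \<le> real n" using that by auto
    have \<epsilon>: "0 < \<epsilon>" "\<epsilon> \<le> pi / 4" using C n by (auto simp: \<epsilon>_def)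
    have "2 * pi * n \<le> C / \<epsilon>"
    proof -
      have "\<epsilon> \<le> C / (2 * pi * n)" by (simp add: \<epsilon>_def)
      then show ?thesis using \<epsilon> n by (simp add: field_simps)
    qed
    also have "\<dots> \<le> \<Theta> T \<epsilon>" using C(2) [of \<epsilon>] \<epsilon> by simp
    finally have "2 * pi * n \<le> \<Theta> T \<epsilon>" .
    moreover have "\<Theta> T (pi / 4) \<le> 2 * pi * n"
    proof -
      have "\<Theta> T (pi / 4) < real n0 * (2 * pi)"
        using n0 by (simp add: pos_divide_less_eq)
      also have "\<dots> \<le> real n * (2 * pi)" using n by simp
      finally show ?thesis by (simp add: mult.commute)
    qed
    ultimately obtain \<theta> where "\<epsilon> \<le> \<theta>" "\<theta> \<le> pi / 4" "\<Theta> T \<theta> = 2 * pi * n"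
      using IVT2' [of "\<Theta> T" "pi / 4" "2 * pi * n" \<epsilon>] \<epsilon> continuous_\<Theta> [of \<epsilon> "pi / 4" T] by auto
    then show ?thesis using \<epsilon> by (intro exI [of _ \<theta>]) auto
  qed
  then show ?thesis using that by metis
qed

end

theorem theorem6p6:
  fixes f :: "complex \<Rightarrow> real^3" and F :: "complex \<Rightarrow> complex \<Rightarrow> real^3"
  assumes "delaunay_surface f"
    and "\<not> part_of_round_sphere f"
    and "\<not> part_of_circular_cylinder f"
    and "associated_family f F"
  shows "\<exists>\<Lambda>. \<Lambda> \<subseteq> sphere 0 1 \<and> infinite \<Lambda> \<and>
           (\<forall>\<mu>\<in>\<Lambda>. \<forall>\<nu>\<in>\<Lambda>. \<mu> \<noteq> \<nu> \<longrightarrow> \<not> congruent_immersions (F \<mu>) (F \<nu>)) \<and>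
           (\<forall>\<mu>\<in>\<Lambda>. screw_motion_symmetric (F \<mu>) \<and> is_cylinder (F \<mu>))"
proof -
  obtain V H Q where f: "band_hopf f V H Q"
    and F: "\<And>\<mu>. norm \<mu> = 1 \<Longrightarrow> band_hopf (F \<mu>) V H (inverse (\<mu>\<^sup>2) * Q)"
    using delaunay_associated_family [OF assms(1,4)] by blast
  have "Q \<noteq> 0"
    using band_hopf.hopf_zero_sphere [OF f] assms(2) by blast
  obtain y0 where y0: "V y0 \<noteq> V 0"
    using band_hopf.constant_metric_cylinder [OF f] assms(3) by blast
  interpret delaunay_family f F V H Q
    by (rule delaunay_family.intro [OF f \<open>Q \<noteq> 0\<close> F])
  obtain T where T: "T > 0" "\<And>y. V (y + T) = V y"
    using sg.periodic by blast
  obtain K where K: "\<And>y. V y \<le> K" "\<And>y. 1 / V y \<le> K"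
    using sg.bounds by blast
  obtain t :: "nat \<Rightarrow> real" and n0 where t: "\<And>n. n0 \<le> n \<Longrightarrow> 0 < t n \<and> t n < pi / 2 \<and> \<Theta> T (t n) = 2 * pi * n"
    using ex_\<Theta> [OF T(1)] by blast
  \<comment> \<open>Different \<open>n\<close> have different total angles and hence different
    phases. These lie where cosine is injective, so the real parts of the Hopf differentials tell
    the members apart.\<close>
  have inj: "m = n" if mn: "n0 \<le> m" "n0 \<le> n" and "Re (rotated_hopf (t m)) = Re (rotated_hopf (t n))" for m n
  proof -
    have "cos (t m) = cos (t n)"
      using that(3) \<kappa>_pos f.H_nonzero by (simp add: rotated_hopf sgn_zero_iff)
    moreover have "0 \<le> t m" "t m \<le> pi" "0 \<le> t n" "t n \<le> pi"
      using t [OF mn(1)] t [OF mn(2)] by linarith+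
    ultimately have "t m = t n"
      using cos_inj_pi by blast
    then have "2 * pi * real m = 2 * pi * real n"
      using t [OF mn(1)] t [OF mn(2)] by metis
    then show ?thesis by simp
  qed
  define \<Lambda> where "\<Lambda> = (\<lambda>n. \<mu> (t n)) ` {n0..}"
  have "inj_on (\<lambda>n. \<mu> (t n)) {n0..}"
    by (rule inj_onI) (metis \<mu>(2) inj atLeast_iff)
  then have "infinite \<Lambda>"
    unfolding \<Lambda>_def by (simp add: finite_image_iff infinite_Ici)
  moreover have "\<Lambda> \<subseteq> sphere 0 1"
    by (auto simp: \<Lambda>_def \<mu>(1))
  moreover have "m = n"
    if mn: "n0 \<le> m" "n0 \<le> n" and cong: "congruent_immersions (F (\<mu> (t m))) (F (\<mu> (t n)))" for m n
    using congruent_hopf_Re [OF F [OF \<mu>(1)] F [OF \<mu>(1)] K y0 cong] inj [OF mn] by (simp add: \<mu>(2))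
  moreover have "screw_motion_symmetric (F (\<mu> (t n))) \<and> is_cylinder (F (\<mu> (t n)))" if "n0 \<le> n" for n
    using cylinder_condition [OF _ _ T, of "t n" "int n"] t [OF that] by auto
  ultimately show ?thesis
    by (intro exI [of _ \<Lambda>]) (auto simp: \<Lambda>_def)
qed

end
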